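(* Let $p\geqslant 3$ be a prime and let $G$ be a finite $p$-group such that $|G'/G''|=p^3$ and $G''\neq 1$. Then $G'$ is isomorphic to $X_{p^3}\times C_p$ or to $Y_{p^3}\times C_p$.
   Context: $G'$ is the derived subgroup of $G$ and $G''=(G')'$ is the second derived subgroup. For an odd prime $p$, $X_{p^3}$ denotes the non-abelian group of order $p^3$ and exponent $p$, and $Y_{p^3}$ denotes the non-abelian group of order $p^3$ and exponent $p^2$ (each unique up to isomorphism). $C_p$ is the cyclic group of order $p$. *)

theory Defs
  imports "HOL-Algebra.Algebra" "HOL-Library.Countable" "HOL-Computational_Algebra.Primes"
begin

definition group_exponent :: "('a, 'b) monoid_scheme \<Rightarrow> nat"
  where "group_exponent G =
    (LEAST n. n > 0 \<and> (\<forall>x \<in> carrier G. x [^]\<^bsub>G\<^esub> n = \<one>\<^bsub>G\<^esub>))"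

definition nonabelian_p3_group :: "nat \<Rightarrow> nat \<Rightarrow> ('a, 'b) monoid_scheme \<Rightarrow> bool"
  where "nonabelian_p3_group p e G \<longleftrightarrow>
    group G \<and> order G = p ^ 3 \<and> \<not> comm_group G \<and> group_exponent G = e"

text \<open>
  For an odd prime \<open>p\<close> the groups below are determined only up to isomorphism.  A representative
  is selected among groups on sets of natural numbers, which contain a copy of every finite group;
  that the choice is not vacuous is shown in \<open>X_p3_props\<close> and \<open>Y_p3_props\<close>.
\<close>

definition X_p3 :: "nat \<Rightarrow> nat monoid"
  where "X_p3 p = (SOME H. nonabelian_p3_group p p H)"

definition Y_p3 :: "nat \<Rightarrow> nat monoid"
  where "Y_p3 p = (SOME H. nonabelian_p3_group p (p ^ 2) H)"

definition derived_subgroup :: "('a, 'b) monoid_scheme \<Rightarrow> ('a, 'b) monoid_scheme"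
  where "derived_subgroup G = G\<lparr>carrier := derived G (carrier G)\<rparr>"


lemma group_exponentI:
  assumes "e > 0" and "\<And>x. x \<in> carrier G \<Longrightarrow> x [^]\<^bsub>G\<^esub> e = \<one>\<^bsub>G\<^esub>"
    and "g \<in> carrier G" and "\<And>n. n > 0 \<Longrightarrow> g [^]\<^bsub>G\<^esub> (n :: nat) = \<one>\<^bsub>G\<^esub> \<Longrightarrow> e \<le> n"
  shows "group_exponent G = e"
  unfolding group_exponent_def using assms by (intro Least_equality) auto

lemma nonabelian_p3_group_iso:
  assumes G: "nonabelian_p3_group p e G" and H: "group H" and iso: "G \<cong> H"
  shows "nonabelian_p3_group p e H"
proof -
  interpret G: group G using G by (simp add: nonabelian_p3_group_def)
  interpret H: group H by (rule H)
  obtain h where h: "h \<in> iso G H" using iso by (auto simp: is_iso_def)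
  then have hom: "h \<in> hom G H" and bij: "bij_betw h (carrier G) (carrier H)"
    by (auto simp: iso_def)
  interpret h: group_hom G H h by unfold_locales (rule hom)
  have ord: "order H = order G"
    using bij_betw_same_card[OF bij] by (simp add: order_def)
  have comm: "\<not> comm_group H"
    using G iso G.iso_sym comm_group.iso_imp_comm_group[of H G] G.is_monoid
    by (auto simp: nonabelian_p3_group_def)
  have pow: "(x [^]\<^bsub>G\<^esub> n = \<one>\<^bsub>G\<^esub>) = (h x [^]\<^bsub>H\<^esub> n = \<one>\<^bsub>H\<^esub>)" if "x \<in> carrier G" for x and n :: nat
    using that bij h.hom_nat_pow[OF that, of n]
    by (metis G.nat_pow_closed G.one_closed bij_betw_imp_inj_on h.hom_one inj_on_eq_iff)
  have "(\<forall>x\<in>carrier G. x [^]\<^bsub>G\<^esub> n = \<one>\<^bsub>G\<^esub>) = (\<forall>y\<in>carrier H. y [^]\<^bsub>H\<^esub> n = \<one>\<^bsub>H\<^esub>)" for n :: nat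
    using pow bij_betw_imp_surj_on[OF bij] by (metis (no_types, lifting) imageE imageI)
  then have "group_exponent H = group_exponent G" by (simp add: group_exponent_def)
  with G ord comm show ?thesis by (simp add: nonabelian_p3_group_def)
qed

lemma nonabelian_p3_group_nat:
  fixes G :: "('a :: countable) monoid"
  assumes G: "nonabelian_p3_group p e G"
  shows "\<exists>H :: nat monoid. nonabelian_p3_group p e H"
proof -
  interpret group G using G by (simp add: nonabelian_p3_group_def)
  have inj: "inj_on to_nat (carrier G)" by (rule inj_on_to_nat)
  have "nonabelian_p3_group p e (image_group to_nat G)"
    using inj_imp_image_group_iso[OF inj] inj_imp_image_group_is_group[OF inj]
    by (intro nonabelian_p3_group_iso[OF G]) (auto simp: is_iso_def)
  then show ?thesis by blast
qed

text \<open>Upper unitriangular \<open>3 \<times> 3\<close> matrices over \<open>\<int>/p\<int>\<close>.\<close>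

definition heis :: "nat \<Rightarrow> (int \<times> int \<times> int) monoid"
  where "heis p = \<lparr>carrier = {0..<int p} \<times> {0..<int p} \<times> {0..<int p},
    monoid.mult = (\<lambda>(a, b, c) (a', b', c').
      ((a + a') mod p, (b + b') mod p, (c + c' + a * b') mod p)),
    one = (0, 0, 0)\<rparr>"

text \<open>The semidirect product of \<open>\<int>/p\<^sup>2\<int>\<close> by \<open>\<int>/p\<int>\<close> with generator acting by \<open>x \<mapsto> (1 + p) x\<close>.\<close>

definition modular :: "nat \<Rightarrow> (int \<times> int) monoid"
  where "modular p = \<lparr>carrier = {0..<int p * int p} \<times> {0..<int p},
    monoid.mult = (\<lambda>(a, b) (a', b').
      ((a + a' + p * (b * a')) mod (int p * int p), (b + b') mod p)),
    one = (0, 0)\<rparr>"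

lemma heis_group:
  assumes "p > 0" shows "group (heis p)"
proof (rule groupI, goal_cases)
  case (3 x y z)
  obtain a b c a' b' c' a'' b'' c'' where xyz: "x = (a, b, c)" "y = (a', b', c')" "z = (a'', b'', c'')"
    by (cases x, cases y, cases z)
  have "((c + c' + a * b') mod p + c'' + ((a + a') mod p) * b'') mod p
     = ((c + c' + a * b') + c'' + (a + a') * b'') mod int p"
    by (intro mod_add_cong mod_mult_cong) (simp_all add: mod_simps)
  also have "\<dots> = (c + (c' + c'' + a' * b'') + a * (b' + b'')) mod int p"
    by (simp add: algebra_simps)
  also have "\<dots> = (c + (c' + c'' + a' * b'') mod p + a * ((b' + b'') mod p)) mod int p"
    by (intro mod_add_cong mod_mult_cong) (simp_all add: mod_simps)
  finally show ?case by (simp add: heis_def xyz mod_simps algebra_simps)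
next
  case (5 x)
  obtain a b c where x: "x = (a, b, c)" by (cases x)
  let ?y = "((- a) mod p, (- b) mod p, (a * b - c) mod p)"
  have "?y \<otimes>\<^bsub>heis p\<^esub> x = \<one>\<^bsub>heis p\<^esub>"
  proof -
    have "((a * b - c) mod p + c + (- a) mod p * b) mod p = ((a * b - c) + c + (- a) * b) mod int p"
      by (intro mod_add_cong mod_mult_cong) (simp_all add: mod_simps)
    then show ?thesis by (simp add: heis_def x mod_simps)
  qed
  moreover have "?y \<in> carrier (heis p)" using assms by (simp add: heis_def)
  ultimately show ?case by blast
qed (use assms in \<open>auto simp: heis_def\<close>)

lemma modular_group:
  assumes "p > 0" shows "group (modular p)"
proof (rule groupI, goal_cases)
  case (3 x y z)
  obtain a b a' b' a'' b'' where xyz: "x = (a, b)" "y = (a', b')" "z = (a'', b'')"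
    by (cases x, cases y, cases z)
  let ?q = "int p * int p"
  have *: "int p * ((b + b') mod p * a'') mod ?q = int p * ((b + b') * a'') mod ?q"
    by (metis mod_mult_left_eq mult_mod_right)
  have **: "int p * (b * ((a' + a'' + int p * (b' * a'')) mod ?q)) mod ?q = int p * (b * (a' + a'')) mod ?q"
  proof -
    have "int p * (b * ((a' + a'' + int p * (b' * a'')) mod ?q)) mod ?q
        = int p * (b * (a' + a'' + int p * (b' * a''))) mod ?q"
      by (metis mod_mult_right_eq)
    also have "int p * (b * (a' + a'' + int p * (b' * a''))) = int p * (b * (a' + a'')) + ?q * (b * (b' * a''))"
      by (simp add: algebra_simps)
    finally show ?thesis by simp
  qed
  have "((a + a' + p * (b * a')) mod ?q + a'' + p * ((b + b') mod p * a'')) mod ?q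
     = (a + a' + p * (b * a') + a'' + p * ((b + b') * a'')) mod ?q"
    by (intro mod_add_cong) (simp_all add: mod_simps *)
  also have "\<dots> = (a + (a' + a'' + p * (b' * a'')) + p * (b * (a' + a''))) mod ?q"
    by (simp add: algebra_simps)
  also have "\<dots> = (a + (a' + a'' + p * (b' * a'')) mod ?q
      + p * (b * ((a' + a'' + p * (b' * a'')) mod ?q))) mod ?q"
    by (intro mod_add_cong) (simp_all add: mod_simps **)
  finally show ?case by (simp add: modular_def xyz mod_simps algebra_simps)
next
  case (5 x)
  obtain a b where x: "x = (a, b)" by (cases x)
  let ?q = "int p * int p"
  let ?y = "((p * (b * a) - a) mod ?q, (- b) mod p)"
  have *: "int p * ((- b) mod p * a) mod ?q = int p * ((- b) * a) mod ?q"
    by (metis mod_mult_left_eq mult_mod_right)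
  have "((p * (b * a) - a) mod ?q + a + p * ((- b) mod p * a)) mod ?q
      = ((p * (b * a) - a) + a + p * ((- b) * a)) mod ?q"
    by (intro mod_add_cong) (simp_all add: mod_simps *)
  then have "?y \<otimes>\<^bsub>modular p\<^esub> x = \<one>\<^bsub>modular p\<^esub>" by (simp add: modular_def x mod_simps)
  moreover have "?y \<in> carrier (modular p)" using assms by (simp add: modular_def)
  ultimately show ?case by blast
qed (use assms in \<open>auto simp: modular_def\<close>)

lemma heis_pow:
  fixes a b c :: int
  assumes "p > 0"
  shows "(a, b, c) [^]\<^bsub>heis p\<^esub> (n :: nat)
    = ((n * a) mod p, (n * b) mod p, (n * c + (n choose 2) * (a * b)) mod p)"
proof (induction n)
  case 0
  then show ?case by (simp add: heis_def binomial_eq_0)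
next
  case (Suc n)
  have "((n * c + (n choose 2) * (a * b)) mod p + c + (n * a) mod p * b) mod p
      = ((n * c + (n choose 2) * (a * b)) + c + (n * a) * b) mod int p"
    by (intro mod_add_cong mod_mult_cong) (simp_all add: mod_simps)
  moreover have "Suc n choose 2 = (n choose 2) + n"
    by (simp add: numeral_2_eq_2)
  ultimately show ?case using Suc
    by (simp add: heis_def nat_pow_Suc mod_simps algebra_simps)
qed

lemma modular_pow:
  fixes a b :: int
  assumes "p > 0"
  shows "(a, b) [^]\<^bsub>modular p\<^esub> (n :: nat)
    = ((n * a + p * ((n choose 2) * (a * b))) mod (int p * int p), (n * b) mod p)"
proof (induction n)
  case 0
  then show ?case by (simp add: modular_def binomial_eq_0)
next
  case (Suc n)
  let ?q = "int p * int p"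
  have *: "int p * ((int n * b) mod p * a) mod ?q = int p * ((int n * b) * a) mod ?q"
    by (metis mod_mult_left_eq mult_mod_right)
  have "((n * a + p * ((n choose 2) * (a * b))) mod ?q + a + p * ((n * b) mod p * a)) mod ?q
      = ((n * a + p * ((n choose 2) * (a * b))) + a + p * ((n * b) * a)) mod ?q"
    by (intro mod_add_cong) (simp_all add: mod_simps *)
  moreover have "Suc n choose 2 = (n choose 2) + n"
    by (simp add: numeral_2_eq_2)
  ultimately show ?case using Suc
    by (simp add: modular_def nat_pow_Suc mod_simps algebra_simps)
qed

lemma heis_nonabelian_p3:
  assumes "Factorial_Ring.prime p" "p \<ge> 3"
  shows "nonabelian_p3_group p p (heis p)"
proof -
  have p: "p > 0" "odd p" using assms prime_odd_nat[of p] by auto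
  have "p choose 2 = p * ((p - 1) div 2)"
    using p by (auto simp: choose_two div_mult_swap)
  then have dvd: "int p dvd int (p choose 2)" by simp
  have "group_exponent (heis p) = p"
  proof (rule group_exponentI)
    fix x assume "x \<in> carrier (heis p)"
    then show "x [^]\<^bsub>heis p\<^esub> p = \<one>\<^bsub>heis p\<^esub>"
      using dvd by (cases x) (auto simp: heis_pow[OF p(1)], auto simp: heis_def)
  next
    fix n :: nat assume n: "n > 0" "(1, 0, 0) [^]\<^bsub>heis p\<^esub> n = \<one>\<^bsub>heis p\<^esub>"
    then have "int n mod int p = 0"
      by (simp only: heis_pow[OF p(1)]) (simp add: heis_def)
    then have "int p dvd int n" by (simp add: dvd_eq_mod_eq_0)
    then have "p dvd n" by (simp only: int_dvd_int_iff)
    then show "p \<le> n" using n by (simp add: dvd_imp_le)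
  qed (use p assms in \<open>auto simp: heis_def\<close>)
  moreover have "order (heis p) = p ^ 3"
    by (simp add: heis_def order_def power3_eq_cube card_cartesian_product)
  moreover have "\<not> comm_group (heis p)"
  proof
    assume "comm_group (heis p)"
    then interpret comm_group "heis p" .
    have "(1, 0, 0) \<otimes>\<^bsub>heis p\<^esub> (0, 1, 0) = (0, 1, 0) \<otimes>\<^bsub>heis p\<^esub> (1, 0, 0)"
      using assms by (intro m_comm) (auto simp: heis_def)
    then show False using assms by (simp add: heis_def)
  qed
  ultimately show ?thesis using heis_group[OF p(1)] by (simp add: nonabelian_p3_group_def)
qed

lemma modular_nonabelian_p3:
  assumes "Factorial_Ring.prime p" "p \<ge> 3"
  shows "nonabelian_p3_group p (p ^ 2) (modular p)"
proof -
  have p: "p > 0" "odd p" using assms prime_odd_nat[of p] by auto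
  have "p * p choose 2 = p * (p * ((p * p - 1) div 2))"
    using p by (auto simp: choose_two div_mult_swap mult.assoc)
  then have dvd: "int p * int p dvd int p * (int (p * p choose 2) * t)" for t :: int
    by simp
  have "group_exponent (modular p) = p ^ 2"
  proof (rule group_exponentI)
    fix x assume "x \<in> carrier (modular p)"
    then show "x [^]\<^bsub>modular p\<^esub> (p ^ 2) = \<one>\<^bsub>modular p\<^esub>"
      using dvd by (cases x) (auto simp: modular_pow[OF p(1)] power2_eq_square, auto simp: modular_def)
  next
    fix n :: nat assume n: "n > 0" "(1, 0) [^]\<^bsub>modular p\<^esub> n = \<one>\<^bsub>modular p\<^esub>"
    then have "int n mod (int p * int p) = 0"
      by (simp only: modular_pow[OF p(1)]) (simp add: modular_def)
    then have "int (p * p) dvd int n" by (simp add: dvd_eq_mod_eq_0)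
    then have "p * p dvd n" by (simp only: int_dvd_int_iff)
    then show "p ^ 2 \<le> n" using n by (simp add: power2_eq_square dvd_imp_le)
  next
    have "int p * 1 \<le> int p * int p" using p by (intro mult_left_mono) auto
    then have "1 < int p * int p" using assms(2) by linarith
    then show "(1, 0) \<in> carrier (modular p)" using p by (simp add: modular_def)
  qed (use p in auto)
  moreover have "order (modular p) = p ^ 3"
    by (simp add: modular_def order_def power3_eq_cube card_cartesian_product nat_mult_distrib)
  moreover have "\<not> comm_group (modular p)"
  proof
    assume "comm_group (modular p)"
    then interpret comm_group "modular p" .
    have lt: "1 + int p < int p * int p"
    proof -
      have "int p * 3 \<le> int p * int p" using assms by (intro mult_left_mono) auto
      then show ?thesis using assms by linarith
    qed
    have "(1, 0) \<otimes>\<^bsub>modular p\<^esub> (0, 1) = (0, 1) \<otimes>\<^bsub>modular p\<^esub> (1, 0)"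
      using assms lt by (intro m_comm) (auto simp: modular_def)
    then show False using assms lt by (simp add: modular_def)
  qed
  ultimately show ?thesis using modular_group[OF p(1)] by (simp add: nonabelian_p3_group_def)
qed

lemma X_p3_props:
  assumes "Factorial_Ring.prime p" "p \<ge> 3"
  shows "nonabelian_p3_group p p (X_p3 p)"
  unfolding X_p3_def
  by (rule someI_ex) (rule nonabelian_p3_group_nat[OF heis_nonabelian_p3[OF assms]])

lemma Y_p3_props:
  assumes "Factorial_Ring.prime p" "p \<ge> 3"
  shows "nonabelian_p3_group p (p ^ 2) (Y_p3 p)"
  unfolding Y_p3_def
  by (rule someI_ex) (rule nonabelian_p3_group_nat[OF modular_nonabelian_p3[OF assms]])

end

theory Submission
  imports Defs
begin

text \<open>
  Write \<open>D = G'\<close> and \<open>W = G''\<close>.  Normal sections of \<open>G\<close> of order \<open>p\<close> are central, and \<open>D\<close>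
  centralizes every normal subgroup of order \<open>p\<^sup>2\<close>.  If \<open>W\<close> had order greater than \<open>p\<close>, then some
  quotient of \<open>G\<close> would have \<open>W\<close> of order \<open>p\<^sup>2\<close>; evaluating a commutator of weight three on a chief
  series of \<open>D\<close> in two ways then gives an element of order \<open>p\<close> that equals its own inverse, which
  is impossible for odd \<open>p\<close>.  So \<open>D\<close> has order \<open>p\<^sup>4\<close> and \<open>W\<close> has order \<open>p\<close>.  Now \<open>Z(D)\<close> has order
  \<open>p\<^sup>2\<close>; since the kernel of the \<open>p\<close>-th power endomorphism of \<open>D\<close> contains a normal subgroup of
  \<open>G\<close> of order \<open>p\<^sup>2\<close>, which must be \<open>Z(D)\<close>, the center is elementary abelian.  Comparing the actions of
  \<open>G\<close> on \<open>D/W\<close> and on \<open>Z(D)\<close>, which are linked by the power map, shows that \<open>D/W\<close> has exponent \<open>p\<close>.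
  Hence a central subgroup of order \<open>p\<close> different from \<open>W\<close> has a complement in \<open>D\<close>, a non-abelian
  group of order \<open>p\<^sup>3\<close>.
\<close>

section \<open>Commutators\<close>

text \<open>The structure of \<open>D\<close> alone cannot give the result. For odd p the free
  class-two group of exponent p on three generators, divided by a subgroup of order p of its derived
  subgroup, has order p^5 and derived subgroup of order p^2. Likewise there is a group of order p^4
  generated by x of order p^2 and y of order p, with [x, y] central of order p and x^p outside the
  derived subgroup. So both exclusions have to use the action of \<open>G\<close> on
  \<open>D\<close>, and they do so in the same way. A normal subgroup S of order p^2 that is not
  central in \<open>G\<close> has a centralizer of index p, and this yields g outside and c inside
  that centralizer such that w = [g, c] acts non-trivially on a larger normal subgroup. Then g c =
  (c g) w is applied to one element and both sides are expanded along a chief series. Reducing to a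
  quotient with \<open>W\<close> of order exactly p^2 makes \<open>D\<close> centralize
  \<open>W\<close>, so that \<open>D\<close> has class two there.\<close>

lemma (in group_hom) order_eq_card_image_kernel:
  assumes "finite (carrier G)"
  shows "order G = card (h ` carrier G) * card (kernel G H h)"
proof -
  let ?I = "H\<lparr>carrier := h ` carrier G\<rparr>"
  have "h \<in> hom G ?I" using homh by (auto simp: hom_def)
  then interpret I: group_hom G ?I h
    using H.subgroup_imp_group[OF img_is_subgroup] G.group_axioms
    by (simp add: group_hom_def group_hom_axioms_def)
  have "(\<lambda>C. the_elem (h ` C)) \<in> iso (G Mod kernel G ?I h) ?I"
    by (rule I.FactGroup_iso_set) simp
  then have "order (G Mod kernel G H h) = card (h ` carrier G)"
    using iso_same_order by (force simp: order_def kernel_def)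
  then show ?thesis
    using G.lagrange_finite[OF assms subgroup_kernel] by (simp add: order_def FactGroup_def)
qed

lemma (in group_hom) card_subgroup_eq:
  assumes "subgroup L G" "finite L"
  shows "card L = card (h ` L) * card {x \<in> L. h x = \<one>\<^bsub>H\<^esub>}"
proof -
  interpret L: group_hom "G\<lparr>carrier := L\<rparr>" H h
    using assms G.subgroup_imp_group H.is_group homh subgroup.mem_carrier[OF assms(1)]
    by (auto simp: group_hom_def group_hom_axioms_def hom_def)
  show ?thesis using L.order_eq_card_image_kernel assms(2)
    by (simp add: order_def kernel_def)
qed

context group
begin

text \<open>With \<open>[a, b] = a\<^sup>-\<^sup>1 b\<^sup>-\<^sup>1 a b\<close>, these are \<open>comm g x = [x, g\<^sup>-\<^sup>1]\<close> and \<open>rcomm g h = [g, h]\<close>.  The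
  former is the factor by which conjugation by \<open>g\<close> changes \<open>x\<close>.\<close>

definition conjg :: "'a \<Rightarrow> 'a \<Rightarrow> 'a" where "conjg g x = g \<otimes> x \<otimes> inv g"
definition comm :: "'a \<Rightarrow> 'a \<Rightarrow> 'a" where "comm g x = inv x \<otimes> conjg g x"
definition rcomm :: "'a \<Rightarrow> 'a \<Rightarrow> 'a" where "rcomm g h = inv (h \<otimes> g) \<otimes> (g \<otimes> h)"

lemma mult_inv_cancel [simp]: "x \<in> carrier G \<Longrightarrow> y \<in> carrier G \<Longrightarrow> x \<otimes> (inv x \<otimes> y) = y"
  by (simp flip: m_assoc)
lemma inv_mult_cancel [simp]: "x \<in> carrier G \<Longrightarrow> y \<in> carrier G \<Longrightarrow> inv x \<otimes> (x \<otimes> y) = y"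
  by (simp flip: m_assoc)

lemma conjg_closed [simp, intro]: "g \<in> carrier G \<Longrightarrow> x \<in> carrier G \<Longrightarrow> conjg g x \<in> carrier G"
  by (simp add: conjg_def)
lemma comm_closed [simp, intro]: "g \<in> carrier G \<Longrightarrow> x \<in> carrier G \<Longrightarrow> comm g x \<in> carrier G"
  by (simp add: comm_def)
lemma rcomm_closed [simp, intro]: "g \<in> carrier G \<Longrightarrow> x \<in> carrier G \<Longrightarrow> rcomm g x \<in> carrier G"
  by (simp add: rcomm_def)

lemma conjg_eq: "g \<in> carrier G \<Longrightarrow> x \<in> carrier G \<Longrightarrow> conjg g x = x \<otimes> comm g x"
  by (simp add: comm_def)
lemma conjg_mult: "g \<in> carrier G \<Longrightarrow> x \<in> carrier G \<Longrightarrow> y \<in> carrier G \<Longrightarrow>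
    conjg g (x \<otimes> y) = conjg g x \<otimes> conjg g y"
  by (simp add: conjg_def m_assoc)
lemma conjg_mult_left: "g \<in> carrier G \<Longrightarrow> h \<in> carrier G \<Longrightarrow> x \<in> carrier G \<Longrightarrow>
    conjg (g \<otimes> h) x = conjg g (conjg h x)"
  by (simp add: conjg_def m_assoc inv_mult_group)
lemma conjg_one [simp]: "g \<in> carrier G \<Longrightarrow> conjg g \<one> = \<one>"
  by (simp add: conjg_def)
lemma conjg_one_left [simp]: "x \<in> carrier G \<Longrightarrow> conjg \<one> x = x"
  by (simp add: conjg_def)
lemma conjg_inv: "g \<in> carrier G \<Longrightarrow> x \<in> carrier G \<Longrightarrow> conjg g (inv x) = inv (conjg g x)"
  by (simp add: conjg_def m_assoc inv_mult_group)
lemma conjg_inv_conjg [simp]: "g \<in> carrier G \<Longrightarrow> x \<in> carrier G \<Longrightarrow> conjg (inv g) (conjg g x) = x"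
  "g \<in> carrier G \<Longrightarrow> x \<in> carrier G \<Longrightarrow> conjg g (conjg (inv g) x) = x"
  by (simp_all flip: conjg_mult_left)
lemma conjg_pow: "g \<in> carrier G \<Longrightarrow> x \<in> carrier G \<Longrightarrow> conjg g (x [^] (n::nat)) = conjg g x [^] n"
  by (induction n) (simp_all add: conjg_mult)

lemma comm_eq_one_iff: "g \<in> carrier G \<Longrightarrow> x \<in> carrier G \<Longrightarrow> comm g x = \<one> \<longleftrightarrow> conjg g x = x"
  unfolding comm_def by (metis conjg_closed inv_closed inv_comm inv_equality inv_inv r_inv)
lemma conjg_eq_iff: "g \<in> carrier G \<Longrightarrow> x \<in> carrier G \<Longrightarrow> conjg g x = x \<longleftrightarrow> g \<otimes> x = x \<otimes> g"
  unfolding conjg_def by (metis inv_solve_right' m_closed)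
lemma comm_eq_one_iff': "g \<in> carrier G \<Longrightarrow> x \<in> carrier G \<Longrightarrow> comm g x = \<one> \<longleftrightarrow> g \<otimes> x = x \<otimes> g"
  by (simp add: comm_eq_one_iff conjg_eq_iff)

lemma comm_one [simp]: "g \<in> carrier G \<Longrightarrow> comm g \<one> = \<one>"
  by (simp add: comm_def)
lemma comm_one_left [simp]: "x \<in> carrier G \<Longrightarrow> comm \<one> x = \<one>"
  by (simp add: comm_def)
lemma comm_mult_left: "g \<in> carrier G \<Longrightarrow> h \<in> carrier G \<Longrightarrow> x \<in> carrier G \<Longrightarrow>
    comm (g \<otimes> h) x = comm g x \<otimes> conjg g (comm h x)"
  by (simp add: comm_def conjg_mult_left conjg_mult conjg_inv m_assoc)
lemma rcomm_one_iff: "g \<in> carrier G \<Longrightarrow> h \<in> carrier G \<Longrightarrow> rcomm g h = \<one> \<longleftrightarrow> g \<otimes> h = h \<otimes> g"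
  unfolding rcomm_def by (metis inv_closed inv_comm inv_equality inv_inv m_closed r_inv)

lemma comm_sym: "g \<in> carrier G \<Longrightarrow> x \<in> carrier G \<Longrightarrow> comm x g = inv (conjg (inv g \<otimes> x) (comm g x))"
  by (simp add: comm_def conjg_def m_assoc inv_mult_group)

text \<open>Because g h = (h g) [g, h], the commutator fixes s exactly when both products move s to
  the same place.\<close>

lemma conjg_rcomm_iff: "g \<in> carrier G \<Longrightarrow> h \<in> carrier G \<Longrightarrow> s \<in> carrier G \<Longrightarrow>
    comm (rcomm g h) s = \<one> \<longleftrightarrow> conjg (g \<otimes> h) s = conjg (h \<otimes> g) s"
proof -
  assume c: "g \<in> carrier G" "h \<in> carrier G" "s \<in> carrier G"
  have "conjg (g \<otimes> h) s = conjg (h \<otimes> g) (conjg (rcomm g h) s)"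
    using c by (subst conjg_mult_left[symmetric]) (simp_all add: rcomm_def)
  then show ?thesis
    using c conjg_inv_conjg(1)[of "h \<otimes> g"] by (metis conjg_closed comm_eq_one_iff rcomm_closed m_closed)
qed

text \<open>Conjugation by either product multiplies s by \<open>comm g s\<close> and
  \<open>comm h s\<close>, in one order or the other, and these factors commute.\<close>

lemma comm_rcomm_eq_one:
  assumes "s \<in> carrier G" "g \<in> carrier G" "h \<in> carrier G"
    and "comm g (comm h s) = \<one>" "comm h (comm g s) = \<one>" "comm g s \<otimes> comm h s = comm h s \<otimes> comm g s"
  shows "comm (rcomm g h) s = \<one>"
proof -
  have e: "conjg g (comm h s) = comm h s" "conjg h (comm g s) = comm g s"
    using assms by (simp_all add: comm_eq_one_iff)
  have "conjg (g \<otimes> h) s = conjg g (s \<otimes> comm h s)" 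
    using assms(1-3) by (subst conjg_eq[symmetric]) (simp_all add: conjg_mult_left)
  also have "\<dots> = s \<otimes> comm g s \<otimes> comm h s"
    using assms(1-3) e by (simp add: conjg_mult conjg_eq[of g s])
  also have "\<dots> = s \<otimes> comm h s \<otimes> comm g s" using assms by (simp add: m_assoc)
  also have "\<dots> = conjg h (s \<otimes> comm g s)"
    using assms(1-3) e by (simp add: conjg_mult conjg_eq[of h s])
  also have "\<dots> = conjg (h \<otimes> g) s"
    using assms(1-3) by (subst conjg_eq[symmetric]) (simp_all add: conjg_mult_left)
  finally show ?thesis using assms by (simp add: conjg_rcomm_iff)
qed

text \<open>\<open>derived\<close> is generated by products with the inverses at the end, while
  \<open>rcomm\<close> has them in front. Inverting both arguments matches the two forms, hence the
  closure of \<open>H\<close> under inverses.\<close>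

lemma derived_subset_iff:
  assumes N: "subgroup N G" and H: "H \<subseteq> carrier G" "\<And>x. x \<in> H \<Longrightarrow> inv x \<in> H"
  shows "derived G H \<subseteq> N \<longleftrightarrow> (\<forall>g\<in>H. \<forall>h\<in>H. rcomm g h \<in> N)"
proof -
  have eq: "rcomm (inv g) (inv h) = g \<otimes> h \<otimes> inv g \<otimes> inv h" if "g \<in> H" "h \<in> H" for g h
    using that H by (simp add: rcomm_def inv_mult_group m_assoc subset_iff)
  have "derived_set G H = (\<Union>g\<in>H. \<Union>h\<in>H. {rcomm g h})" (is "_ = ?R")
  proof
    show "derived_set G H \<subseteq> ?R"
    proof clarify
      fix g h assume gh: "g \<in> H" "h \<in> H"
      then show "g \<otimes> h \<otimes> inv g \<otimes> inv h \<in> ?R" unfolding eq[OF gh, symmetric] using H(2) by blast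
    qed
    show "?R \<subseteq> derived_set G H"
    proof clarify
      fix g h assume gh: "g \<in> H" "h \<in> H"
      have "rcomm g h = inv g \<otimes> inv h \<otimes> inv (inv g) \<otimes> inv (inv h)"
        using eq[OF H(2)[OF gh(1)] H(2)[OF gh(2)]] gh H(1) by (simp add: subset_iff)
      then show "rcomm g h \<in> derived_set G H" using gh H(2) by blast
    qed
  qed
  moreover have "generate G S \<subseteq> N \<longleftrightarrow> S \<subseteq> N" for S
    using generate_subgroup_incl[OF _ N] generate.incl[of _ S G] by blast
  ultimately show ?thesis unfolding derived_def by (simp only:) blast
qed

lemma rcomm_in_derived: "subgroup H G \<Longrightarrow> g \<in> H \<Longrightarrow> h \<in> H \<Longrightarrow> rcomm g h \<in> derived G H"
proof -
  assume H: "subgroup H G" "g \<in> H" "h \<in> H"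
  have "\<forall>g\<in>H. \<forall>h\<in>H. rcomm g h \<in> derived G H"
    using subgroup.subset[OF H(1)] subgroup.m_inv_closed[OF H(1)]
    by (subst derived_subset_iff[symmetric]) (simp_all add: derived_is_subgroup)
  with H show ?thesis by blast
qed

lemma comm_in_derived: "subgroup H G \<Longrightarrow> g \<in> H \<Longrightarrow> h \<in> H \<Longrightarrow> comm g h \<in> derived G H"
proof -
  assume H: "subgroup H G" "g \<in> H" "h \<in> H"
  then have c: "g \<in> carrier G" "h \<in> carrier G" by (auto dest: subgroup.mem_carrier)
  have "comm g h = rcomm h (inv g)"
    using c by (simp add: comm_def rcomm_def conjg_def inv_mult_group m_assoc)
  then show ?thesis using rcomm_in_derived[OF H(1)] H by (simp add: subgroup.m_inv_closed)
qed

end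

lemma (in normal) conjg_mem: "g \<in> carrier G \<Longrightarrow> x \<in> H \<Longrightarrow> conjg g x \<in> H"
  unfolding conjg_def by (rule inv_op_closed2)


lemma (in group) normalI_conjg:
  assumes "subgroup N G" "\<And>g x. g \<in> carrier G \<Longrightarrow> x \<in> N \<Longrightarrow> conjg g x \<in> N"
  shows "N \<lhd> G"
  using assms by (intro normal_invI) (auto simp: conjg_def)

section \<open>Commutators under homomorphisms and modulo normal subgroups\<close>

lemma (in group_hom) hom_conjg: "g \<in> carrier G \<Longrightarrow> x \<in> carrier G \<Longrightarrow> h (G.conjg g x) = H.conjg (h g) (h x)"
  by (simp add: G.conjg_def H.conjg_def)
lemma (in group_hom) hom_comm: "g \<in> carrier G \<Longrightarrow> x \<in> carrier G \<Longrightarrow> h (G.comm g x) = H.comm (h g) (h x)"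
  by (simp add: G.comm_def H.comm_def hom_conjg)
lemma (in group_hom) hom_rcomm: "g \<in> carrier G \<Longrightarrow> x \<in> carrier G \<Longrightarrow> h (G.rcomm g x) = H.rcomm (h g) (h x)"
  by (simp add: G.rcomm_def H.rcomm_def)

lemma (in normal) quotient_hom: "group_hom G (G Mod H) ((#>) H)"
  using factorgroup_is_group r_coset_hom_Mod
  by (auto simp: group_hom_def group_hom_axioms_def is_group)

lemma (in normal) coset_eq_one_iff: "x \<in> carrier G \<Longrightarrow> H #> x = \<one>\<^bsub>G Mod H\<^esub> \<longleftrightarrow> x \<in> H"
  using coset_join1[OF _ _ subgroup_axioms] coset_join2[OF _ subgroup_axioms] subset by auto

text \<open>This is \<open>comm_rcomm_eq_one\<close> in the quotient by \<open>H\<close>; the last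
  hypothesis says that the two commutators commute there.\<close>

lemma (in normal) comm_rcomm_mem:
  assumes "s \<in> carrier G" "g \<in> carrier G" "h \<in> carrier G"
    and "comm g (comm h s) \<in> H" "comm h (comm g s) \<in> H" "comm (comm g s) (comm h s) \<in> H"
  shows "comm (rcomm g h) s \<in> H"
proof -
  interpret q: group_hom G "G Mod H" "(#>) H" by (rule quotient_hom)
  have iff: "x \<in> H \<longleftrightarrow> H #> x = \<one>\<^bsub>G Mod H\<^esub>" if "x \<in> carrier G" for x
    using that coset_eq_one_iff by blast
  show ?thesis
    using assms q.H.comm_rcomm_eq_one[of "H #> s" "H #> g" "H #> h"]
    by (simp del: one_FactGroup mult_FactGroup add: iff q.hom_comm q.hom_rcomm q.H.comm_eq_one_iff'[of "q.H.comm _ _"])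
qed

text \<open>The three subgroup lemma for \<open>[G, G, s]\<close>.\<close>

lemma (in normal) comm_derived_mem:
  assumes s: "s \<in> carrier G"
    and c: "\<And>g h. g \<in> carrier G \<Longrightarrow> h \<in> carrier G \<Longrightarrow> comm g (comm h s) \<in> H"
    and d: "d \<in> derived G (carrier G)"
  shows "comm d s \<in> H"
proof -
  \<comment> \<open>The elements that centralize s modulo \<open>H\<close> form a subgroup, so it is
    enough to treat the generating commutators.\<close>
  let ?N = "{d \<in> carrier G. comm d s \<in> H}"
  have "subgroup ?N G"
  proof (rule subgroupI)
    fix a assume a: "a \<in> ?N"
    have "comm (inv a) s = conjg (inv a) (inv (comm a s))"
      using a s by (simp add: comm_def conjg_def m_assoc inv_mult_group)
    then show "inv a \<in> ?N" using a by (simp add: conjg_mem)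
  next
    fix a b assume "a \<in> ?N" "b \<in> ?N"
    then show "a \<otimes> b \<in> ?N" using s by (simp add: comm_mult_left conjg_mem)
  qed (use s in auto)
  then have "derived G (carrier G) \<subseteq> ?N"
    using s c by (subst derived_subset_iff) (auto intro!: comm_rcomm_mem)
  with d show ?thesis by blast
qed

section \<open>Normal subgroups of finite \<open>p\<close>-groups\<close>

lemma (in subgroup) nat_pow_mem: "x \<in> H \<Longrightarrow> x [^] (n::nat) \<in> H"
  by (induction n) auto

lemma (in group) prime_order_subgroup:
  assumes P: "subgroup P G" "card P = p" and p: "Factorial_Ring.prime p"
    and fin: "finite (carrier G)" and s: "s \<in> P" "s \<noteq> \<one>"
  shows "s [^] (i::nat) = \<one> \<longleftrightarrow> p dvd i" and "t \<in> P \<Longrightarrow> \<exists>i::nat. t = s [^] i"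
proof -
  have c: "s \<in> carrier G" using s P(1) by (auto dest: subgroup.mem_carrier)
  have sub: "generate G {s} \<subseteq> P" using s P(1) by (intro generate_subgroup_incl) auto
  have finP: "finite P" using P(1) fin by (meson finite_subset subgroup.subset)
  interpret P: group "G\<lparr>carrier := P\<rparr>" using P(1) by (rule subgroup_imp_group)
  have "subgroup (generate G {s}) (G\<lparr>carrier := P\<rparr>)"
    using sub P(1) c by (intro subgroup_incl generate_is_subgroup) auto
  then have "card (generate G {s}) dvd p"
    using P.lagrange[of "generate G {s}"] P(2) unfolding order_def by (simp, metis dvd_triv_right)
  moreover have o: "ord s = card (generate G {s})" by (rule generate_pow_card[OF c])
  moreover have "ord s \<noteq> 1" using ord_eq_1[OF c] s by simp
  ultimately have ord: "ord s = p" using p by (metis prime_nat_iff)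
  then show "s [^] i = \<one> \<longleftrightarrow> p dvd i" using pow_eq_id[OF c] by simp
  have "generate G {s} = P" using ord o sub finP P(2) by (intro card_subset_eq) auto
  then show "\<exists>i::nat. t = s [^] i" if "t \<in> P"
    using that generate_pow_on_finite_carrier[OF fin c] by blast
qed

lemma (in normal) card_image_coset:
  assumes "subgroup L G" "finite L" "H \<subseteq> L"
  shows "card L = card ((#>) H ` L) * card H"
proof -
  interpret q: group_hom G "G Mod H" "(#>) H" by (rule quotient_hom)
  have "{x \<in> L. H #> x = \<one>\<^bsub>G Mod H\<^esub>} = H"
    using assms subgroup.mem_carrier[OF assms(1)] coset_eq_one_iff by blast
  then show ?thesis using q.card_subgroup_eq[OF assms(1,2)] by simp
qed

text \<open>The section \<open>L\<close>/\<open>H\<close> is cyclic of order p, generated by any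
  element outside \<open>H\<close>. Along a chief series this supplies coordinates, one exponent for
  each layer.\<close>

lemma (in normal) prime_index_powers:
  assumes L: "subgroup L G" "H \<subseteq> L" "card L = p * card H" and p: "Factorial_Ring.prime p"
    and fin: "finite (carrier G)" and s: "s \<in> L" "s \<notin> H"
  shows "s [^] (i::nat) \<in> H \<longleftrightarrow> p dvd i"
    and "t \<in> L \<Longrightarrow> \<exists>i::nat. \<exists>n\<in>H. t = s [^] i \<otimes> n"
proof -
  interpret q: group_hom G "G Mod H" "(#>) H" by (rule quotient_hom)
  have finL: "finite L" using L(1) fin by (meson finite_subset subgroup.subset)
  have H0: "card H > 0" using finite_subset[OF L(2) finL] subgroup.one_closed[OF subgroup_axioms]
    by (metis card_gt_0_iff empty_iff)
  have cP: "card ((#>) H ` L) = p"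
    using card_image_coset[OF L(1) finL L(2)] L(3) H0 by simp
  have P: "subgroup ((#>) H ` L) (G Mod H)" using L(1) by (rule q.subgroup_img_is_subgroup)
  have finQ: "finite (carrier (G Mod H))" using fin by (simp add: carrier_FactGroup)
  have c: "s \<in> carrier G" using s L(1) by (auto dest: subgroup.mem_carrier)
  have ne: "H #> s \<noteq> \<one>\<^bsub>G Mod H\<^esub>" using coset_eq_one_iff[OF c] s by simp
  note o = q.H.prime_order_subgroup[OF P cP p finQ imageI[OF s(1)] ne]
  have pow: "H #> (s [^] i) = (H #> s) [^]\<^bsub>G Mod H\<^esub> i" for i :: nat
    using q.hom_nat_pow[OF c] .
  show "s [^] i \<in> H \<longleftrightarrow> p dvd i"
    using o(1)[of i] coset_eq_one_iff[of "s [^] i"] c by (simp only: pow nat_pow_closed)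
  show "\<exists>i::nat. \<exists>n\<in>H. t = s [^] i \<otimes> n" if t: "t \<in> L"
  proof -
    have ct: "t \<in> carrier G" using t L(1) by (auto dest: subgroup.mem_carrier)
    obtain i :: nat where i: "H #> t = H #> (s [^] i)" using o(2)[OF imageI[OF t]] pow by metis
    have "inv (s [^] i) \<otimes> t \<in> H"
      using i c ct coset_eq_one_iff[of "inv (s [^] i) \<otimes> t"]
      by (simp del: one_FactGroup mult_FactGroup)
    moreover have "t = s [^] i \<otimes> (inv (s [^] i) \<otimes> t)" using c ct by simp
    ultimately show ?thesis by blast
  qed
qed

section \<open>Central elements, chief series and central chief factors\<close>

locale p_group = group +
  fixes p :: nat
  assumes prime: "Factorial_Ring.prime p" and fin: "finite (carrier G)"
    and order_eq_power: "\<exists>n. order G = p ^ n"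
begin

lemma finite_subgroup: "subgroup H G \<Longrightarrow> finite H"
  using fin by (meson finite_subset subgroup.subset)

lemma card_subgroup: "subgroup H G \<Longrightarrow> \<exists>k. card H = p ^ k"
  using lagrange[of H] order_eq_power divides_primepow_nat[OF prime] by (metis dvd_triv_right)

lemma p_group_quotient: "N \<lhd> G \<Longrightarrow> p_group (G Mod N) p"
proof -
  assume N: "N \<lhd> G"
  then interpret N: normal N G .
  interpret q: group_hom G "G Mod N" "(#>) N" by (rule N.quotient_hom)
  obtain n where "p ^ n = card (rcosets N) * card N"
    using lagrange[OF N.subgroup_axioms] order_eq_power by metis
  then have "\<exists>k. card (rcosets N) = p ^ k"
    using divides_primepow_nat[OF prime] by (metis dvd_triv_left)
  then show ?thesis using prime fin
    by unfold_locales (auto simp: order_def FactGroup_def RCOSETS_def)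
qed

text \<open>The class equation for the action on \<open>M\<close> by conjugation.\<close>

lemma central_element:
  assumes M: "M \<lhd> G" "M \<noteq> {\<one>}"
  shows "\<exists>z\<in>M. z \<noteq> \<one> \<and> z [^] p = \<one> \<and> (\<forall>g\<in>carrier G. comm g z = \<one>)"
proof -
  interpret M: normal M G by (rule M)
  let ?\<phi> = "\<lambda>g. \<lambda>h \<in> carrier G. g \<otimes> h \<otimes> inv g"
  interpret A: group_action G "carrier G" ?\<phi> by (rule action_by_conjugation)
  have orbit: "orbit G ?\<phi> x = {conjg g x |g. g \<in> carrier G}" if "x \<in> carrier G" for x
    using that by (auto simp: orbit_def conjg_def)
  \<comment> \<open>\<open>?F\<close> collects the fixed points in \<open>M\<close>. All other
    orbits have more than one element, hence length divisible by p.\<close>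
  let ?F = "{z \<in> M. \<forall>g\<in>carrier G. comm g z = \<one>}"
  let ?C = "orbit G ?\<phi> ` (M - ?F)"
  have finM: "finite M" by (rule finite_subgroup[OF M.subgroup_axioms])
  have in_orbit: "x \<in> orbit G ?\<phi> x" if "x \<in> carrier G" for x
    using that A.orbit_refl by blast
  have sub: "orbit G ?\<phi> x \<subseteq> M - ?F" if x: "x \<in> M - ?F" for x
  proof
    fix y assume "y \<in> orbit G ?\<phi> x"
    then obtain g where g: "g \<in> carrier G" "y = conjg g x" using x orbit[of x] M.mem_carrier by auto
    then have xy: "x = conjg (inv g) y" using x M.mem_carrier by simp
    have "y \<notin> ?F"
    proof
      assume "y \<in> ?F"
      then have "comm h y = \<one>" if "h \<in> carrier G" for h using that by blast
      moreover have yc: "y \<in> carrier G" using g x M.mem_carrier by simp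
      ultimately have "conjg (inv g) y = y" using g(1) comm_eq_one_iff[of "inv g" y] by simp
      then have "x = y" using xy by simp
      with \<open>y \<in> ?F\<close> x show False by simp
    qed
    then show "y \<in> M - ?F" using g x M.conjg_mem by simp
  qed
  have U: "\<Union>?C = M - ?F" using sub in_orbit M.mem_carrier by blast
  have "p dvd card (\<Union>?C)"
  proof (rule dvd_partition)
    show "finite (\<Union>?C)" unfolding U using finM by simp
    show "\<forall>c1\<in>?C. \<forall>c2\<in>?C. c1 \<noteq> c2 \<longrightarrow> c1 \<inter> c2 = {}"
    proof (intro ballI impI, rule ccontr)
      fix c d assume c: "c \<in> ?C" "d \<in> ?C" "c \<noteq> d" "c \<inter> d \<noteq> {}"
      then obtain x y where "x \<in> M" "y \<in> M" and o: "c = orbit G ?\<phi> x" "d = orbit G ?\<phi> y"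
        by blast
      then have xy: "x \<in> carrier G" "y \<in> carrier G" "c = orbit G ?\<phi> x" "d = orbit G ?\<phi> y"
        using M.mem_carrier by auto
      obtain z where z: "z \<in> c" "z \<in> d" using c by blast
      have "c \<in> orbits G (carrier G) ?\<phi>" "d \<in> orbits G (carrier G) ?\<phi>"
        using xy unfolding orbits_def by blast+
      moreover have "z \<in> carrier G" using z(1) xy(1) orbit[OF xy(1)] xy(3) by auto
      ultimately show False
        using A.orbit_partition z c(3) unfolding partition_def by blast
    qed
    show "\<forall>c\<in>?C. p dvd card c"
    proof
      fix c assume "c \<in> ?C"
      then obtain x where x: "x \<in> M" "x \<notin> ?F" "c = orbit G ?\<phi> x" by blast
      then have xc: "x \<in> carrier G" using M.mem_carrier by blast
      obtain n where "card c * card (stabilizer G ?\<phi> x) = p ^ n"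
        using A.orbit_stabilizer_theorem[OF xc] x(3) order_eq_power by auto
      then have "card c dvd p ^ n" by (rule dvdI[OF sym])
      then obtain k where k: "card c = p ^ k" using divides_primepow_nat[OF prime] by blast
      have "card c \<noteq> 1"
      proof
        assume "card c = 1"
        then obtain y where "c = {y}" by (auto simp: card_1_singleton_iff)
        moreover have "x \<in> c" using in_orbit[OF xc] x(3) by simp
        moreover have "conjg g x \<in> c" if "g \<in> carrier G" for g
          using that orbit[OF xc] x(3) by blast
        ultimately have "conjg g x = x" if "g \<in> carrier G" for g
          using that by (metis singletonD)
        then show False using x xc by (simp add: comm_eq_one_iff)
      qed
      then show "p dvd card c" using k by (cases k) auto
    qed
  qed
  then have 1: "p dvd card (M - ?F)" by (simp only: U)
  have "\<one> \<in> M" by (rule subgroup.one_closed[OF M.subgroup_axioms])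
  have c1: "card M \<noteq> 1"
  proof
    assume "card M = 1"
    then obtain y where "M = {y}" by (rule card_1_singletonE)
    with \<open>\<one> \<in> M\<close> M(2) show False by simp
  qed
  obtain k where k: "card M = p ^ k" using card_subgroup[OF M.subgroup_axioms] by blast
  then have 2: "p dvd card M" using c1 by (cases k) auto
  have eq: "card M = card (M - ?F) + card ?F"
    using finM card_mono[of M ?F] by (subst card_Diff_subset) auto
  have "p dvd card (M - ?F) + card ?F" using 2 by (simp only: eq)
  \<comment> \<open>The identity is one fixed point and their number is a multiple of p, so there is
    another.\<close>
  with 1 have "p dvd card ?F" by (simp only: dvd_add_right_iff)
  then have "?F \<noteq> {\<one>}"
  proof (rule contrapos_pn)
    assume F: "?F = {\<one>}"
    have "\<not> p dvd card {\<one>}" using prime_gt_1_nat[OF prime] by simp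
    then show "\<not> p dvd card ?F" unfolding F .
  qed
  moreover have "\<one> \<in> ?F" using \<open>\<one> \<in> M\<close> by simp
  moreover have "\<exists>z\<in>A. z \<noteq> a" if "A \<noteq> {a}" "a \<in> A" for A and a :: 'a
    using that by blast
  ultimately obtain z where z: "z \<in> ?F" "z \<noteq> \<one>" by (metis (no_types, lifting))
  then have zc: "z \<in> carrier G" using M.mem_carrier by blast
  obtain n where "order G = p ^ n" using order_eq_power by blast
  then have "ord z dvd p ^ n" using ord_dvd_group_order[OF zc] by simp
  then obtain j where j: "ord z = p ^ j" using divides_primepow_nat[OF prime] by metis
  then obtain i where i: "j = Suc i" using ord_eq_1[OF zc] z(2) by (cases j) auto
  \<comment> \<open>The order of z is p^(i + 1), so this power has order p.\<close>
  let ?y = "z [^] (p ^ i)"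
  have "?y [^] p = \<one>" using zc j i by (simp add: nat_pow_pow pow_eq_id mult.commute)
  moreover have "?y \<noteq> \<one>"
    using zc j i prime prime_gt_1_nat[OF prime] by (simp add: pow_eq_id power_dvd_imp_le)
  moreover have "comm g ?y = \<one>" if g: "g \<in> carrier G" for g
    using z(1) g zc by (simp add: comm_eq_one_iff conjg_pow)
  moreover have "?y \<in> M" using z(1) M.nat_pow_mem by simp
  ultimately show ?thesis by blast
qed

text \<open>Take a central element of order p in the image of \<open>M\<close> in the quotient by
  \<open>N\<close>. The subgroup that it generates is central, hence normal, and its preimage is
  \<open>L\<close>.\<close>

lemma normal_step:
  assumes N: "N \<lhd> G" and M: "M \<lhd> G" and NM: "N \<subset> M"
  shows "\<exists>L. L \<lhd> G \<and> N \<subseteq> L \<and> L \<subseteq> M \<and> card L = p * card N"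
proof -
  interpret N: normal N G by (rule N)
  interpret M: normal M G by (rule M)
  interpret Q: p_group "G Mod N" p by (rule p_group_quotient[OF N])
  interpret q: group_hom G "G Mod N" "(#>) N" by (rule N.quotient_hom)
  let ?q = "(#>) N"
  have M': "?q ` M \<lhd> G Mod N"
    by (rule M.surj_hom_normal_subgroup[OF q.group_hom_axioms]) (simp add: carrier_FactGroup)
  obtain x where x: "x \<in> M" "x \<notin> N" using NM by blast
  then have "?q x \<noteq> \<one>\<^bsub>G Mod N\<^esub>" using N.coset_eq_one_iff[OF M.mem_carrier] by simp
  then have "?q ` M \<noteq> {\<one>\<^bsub>G Mod N\<^esub>}" using x by blast
  from Q.central_element[OF M' this] obtain z where z: "z \<in> ?q ` M" "z \<noteq> \<one>\<^bsub>G Mod N\<^esub>"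
      "z [^]\<^bsub>G Mod N\<^esub> p = \<one>\<^bsub>G Mod N\<^esub>" and zc: "\<forall>g\<in>carrier (G Mod N). Q.comm g z = \<one>\<^bsub>G Mod N\<^esub>"
    by (elim bexE conjE) (rule that; assumption)
  have zq: "z \<in> carrier (G Mod N)" using z(1) M.subset by (auto simp: carrier_FactGroup)
  let ?P = "generate (G Mod N) {z}"
  have P: "subgroup ?P (G Mod N)" using zq by (intro Q.generate_is_subgroup) auto
  have "Q.ord z = p"
    using z zq prime Q.pow_eq_id[OF zq] Q.ord_eq_1[OF zq] by (metis prime_nat_iff)
  then have cP: "card ?P = p" using Q.generate_pow_card[OF zq] by simp
  have PM: "?P \<subseteq> ?q ` M"
    using z(1) M' by (intro Q.generate_subgroup_incl) (auto dest: normal_imp_subgroup)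
  have cen: "Q.conjg g y = y" if g: "g \<in> carrier (G Mod N)" and y: "y \<in> ?P" for g y
  proof -
    obtain k :: nat where "y = z [^]\<^bsub>G Mod N\<^esub> k"
      using y Q.generate_pow_on_finite_carrier[OF Q.fin zq] by blast
    then show ?thesis using bspec[OF zc g] g zq
      by (simp del: one_FactGroup mult_FactGroup add: Q.conjg_pow Q.comm_eq_one_iff)
  qed
  let ?L = "{x \<in> carrier G. ?q x \<in> ?P}"
  have L: "subgroup ?L G"
    using subgroup.m_inv_closed[OF P] subgroup.m_closed[OF P] subgroup.one_closed[OF P]
    by (intro subgroupI) (auto simp del: one_FactGroup mult_FactGroup intro!: exI[of _ \<one>])
  have Ln: "?L \<lhd> G"
    using cen by (intro normalI_conjg[OF L]) (auto simp del: one_FactGroup mult_FactGroup simp: q.hom_conjg)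
  have NL: "N \<subseteq> ?L"
  proof
    fix x assume "x \<in> N"
    then have "x \<in> carrier G" "?q x = \<one>\<^bsub>G Mod N\<^esub>" using N.mem_carrier N.coset_eq_one_iff by blast+
    then show "x \<in> ?L" using subgroup.one_closed[OF P] by simp
  qed
  have LM: "?L \<subseteq> M"
  proof
    fix x assume "x \<in> ?L"
    then obtain m where x: "x \<in> carrier G" and m: "m \<in> M" "?q x = ?q m" using PM by blast
    have mc: "m \<in> carrier G" using m M.mem_carrier by blast
    have "?q (x \<otimes> inv m) = \<one>\<^bsub>G Mod N\<^esub>"
      using m(2) x mc by (simp del: one_FactGroup mult_FactGroup)
    then have "x \<otimes> inv m \<in> M" using N.coset_eq_one_iff[of "x \<otimes> inv m"] x mc NM by auto
    then have "x \<otimes> inv m \<otimes> m \<in> M" using m(1) M.m_closed by blast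
    then show "x \<in> M" using x mc by (simp add: m_assoc)
  qed
  have "?q ` ?L = ?P"
    using subgroup.subset[OF P] by (auto simp: carrier_FactGroup)
  then have "card ?L = p * card N"
    using N.card_image_coset[OF L finite_subgroup[OF L] NL] cP by simp
  with Ln NL LM show ?thesis by blast
qed

lemma normal_chain:
  assumes N: "N \<lhd> G" "card N = p ^ n" and M: "M \<lhd> G" "card M = p ^ m" and NM: "N \<subseteq> M"
    and "n \<le> j" "j \<le> m"
  shows "\<exists>L. L \<lhd> G \<and> N \<subseteq> L \<and> L \<subseteq> M \<and> card L = p ^ j"
  using \<open>n \<le> j\<close> \<open>j \<le> m\<close>
proof (induction j rule: dec_induct)
  case base
  then show ?case using N NM by blast
next
  case (step j)
  then obtain L where L: "L \<lhd> G" "N \<subseteq> L" "L \<subseteq> M" "card L = p ^ j" by auto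
  have "card L \<noteq> card M" using L(4) M(2) step prime_gt_1_nat[OF prime] by auto
  then have "L \<subset> M" using L(3) by blast
  from normal_step[OF L(1) M(1) this] obtain L' where
    "L' \<lhd> G" "L \<subseteq> L'" "L' \<subseteq> M" "card L' = p * card L" by blast
  then show ?case using L by auto
qed

text \<open>The image of \<open>L\<close> modulo \<open>N\<close> is normal of order p, so the
  non-trivial central element that it contains generates it.\<close>

lemma central_section:
  assumes N: "N \<lhd> G" and L: "L \<lhd> G" "N \<subseteq> L" "card L = p * card N"
    and l: "l \<in> L" and g: "g \<in> carrier G"
  shows "comm g l \<in> N"
proof -
  interpret N: normal N G by (rule N)
  interpret L: normal L G by (rule L)
  interpret Q: p_group "G Mod N" p by (rule p_group_quotient[OF N])
  interpret q: group_hom G "G Mod N" "(#>) N" by (rule N.quotient_hom)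
  have finL: "finite L" by (rule finite_subgroup[OF L.subgroup_axioms])
  have "card N > 0" using finite_subgroup[OF N.subgroup_axioms] subgroup.one_closed[OF N.subgroup_axioms]
    by (metis card_gt_0_iff empty_iff)
  then have cP: "card ((#>) N ` L) = p"
    using N.card_image_coset[OF L.subgroup_axioms finL L(2)] L(3) by simp
  have P: "(#>) N ` L \<lhd> G Mod N"
    by (rule L.surj_hom_normal_subgroup[OF q.group_hom_axioms]) (simp add: carrier_FactGroup)
  have "(#>) N ` L \<noteq> {\<one>\<^bsub>G Mod N\<^esub>}" using cP prime by (metis is_singletonI is_singleton_altdef not_prime_1)
  from Q.central_element[OF P this] obtain z where z: "z \<in> (#>) N ` L" "z \<noteq> \<one>\<^bsub>G Mod N\<^esub>"
    and zc: "\<forall>g\<in>carrier (G Mod N). Q.comm g z = \<one>\<^bsub>G Mod N\<^esub>"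
    by (elim bexE conjE) (rule that; assumption)
  have zq: "z \<in> carrier (G Mod N)" using z(1) L.subset by (auto simp: carrier_FactGroup)
  obtain i :: nat where i: "N #> l = z [^]\<^bsub>G Mod N\<^esub> i"
    using Q.prime_order_subgroup(2)[OF normal_imp_subgroup[OF P] cP prime Q.fin z(1,2)] l by blast
  have lc: "l \<in> carrier G" using l L.mem_carrier by blast
  have gq: "N #> g \<in> carrier (G Mod N)" using g by (simp add: carrier_FactGroup)
  have "N #> comm g l = \<one>\<^bsub>G Mod N\<^esub>"
    unfolding q.hom_comm[OF g lc] i using bspec[OF zc gq] zq gq
    by (simp del: one_FactGroup mult_FactGroup add: Q.conjg_pow Q.comm_eq_one_iff)
  then show ?thesis using N.coset_eq_one_iff[of "comm g l"] g lc by simp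
qed

end

section \<open>Centralizers and groups of class two\<close>

context group
begin

lemma centralizer_subgroup:
  assumes "subgroup D G" "s \<in> carrier G"
  shows "subgroup {d \<in> D. comm d s = \<one>} G"
proof -
  interpret D: subgroup D G by fact
  show ?thesis
  proof (rule subgroupI)
    fix a assume a: "a \<in> {d \<in> D. comm d s = \<one>}"
    then have "a \<in> carrier G" "comm a s = \<one>" using D.mem_carrier by auto
    then have "conjg a s = s" using assms(2) by (simp add: comm_eq_one_iff)
    then have "conjg (inv a) s = s" using a assms(2) conjg_inv_conjg(1)[of a s] by simp
    then show "inv a \<in> {d \<in> D. comm d s = \<one>}" using a assms(2) by (simp add: comm_eq_one_iff)
  qed (use assms(2) in \<open>auto simp: comm_mult_left intro!: exI[of _ \<one>]\<close>)
qed

lemma centralizer_normal: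
  assumes "S \<lhd> G"
  shows "{g \<in> carrier G. \<forall>s\<in>S. comm g s = \<one>} \<lhd> G" (is "?C \<lhd> G")
proof -
  interpret S: normal S G by fact
  have "S \<noteq> {}" using subgroup.one_closed[OF S.subgroup_axioms] by blast
  then have "subgroup (\<Inter>s\<in>S. {g \<in> carrier G. comm g s = \<one>}) G"
    using S.mem_carrier
    by (intro subgroups_Inter) (auto intro!: centralizer_subgroup subgroup_self)
  moreover have "(\<Inter>s\<in>S. {g \<in> carrier G. comm g s = \<one>}) = ?C"
    using \<open>S \<noteq> {}\<close> by auto
  ultimately have sub: "subgroup ?C G" by simp
  show ?thesis
  proof (rule normalI_conjg[OF sub])
    fix g c assume g: "g \<in> carrier G" and c: "c \<in> ?C"
    have "comm (conjg g c) s = \<one>" if s: "s \<in> S" for s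
    proof -
      have sc: "s \<in> carrier G" using s S.mem_carrier by blast
      have "conjg (conjg g c) s = conjg g (conjg c (conjg (inv g) s))"
        using g c sc by (simp add: conjg_def m_assoc inv_mult_group)
      also have "conjg c (conjg (inv g) s) = conjg (inv g) s"
      proof -
        have "comm c (conjg (inv g) s) = \<one>" using c S.conjg_mem[OF inv_closed[OF g] s] by blast
        then show ?thesis using c g sc by (simp add: comm_eq_one_iff)
      qed
      finally show ?thesis using g sc c by (simp add: comm_eq_one_iff)
    qed
    then show "conjg g c \<in> ?C" using g c by simp
  qed
qed

text \<open>The commutator with \<open>s\<close> is a homomorphism from \<open>D\<close> onto \<open>K\<close>.\<close>

lemma centralizer_index:
  assumes fin: "finite (carrier G)" and p: "Factorial_Ring.prime p"
    and D: "subgroup D G" and K: "subgroup K G" "card K = p"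
    and DK: "\<And>d k. d \<in> D \<Longrightarrow> k \<in> K \<Longrightarrow> comm d k = \<one>"
    and s: "s \<in> carrier G" "\<And>d. d \<in> D \<Longrightarrow> comm d s \<in> K"
    and g: "g \<in> D" "comm g s \<noteq> \<one>"
  shows "card D = p * card {d \<in> D. comm d s = \<one>}"
    and "t \<in> D \<Longrightarrow> \<exists>i::nat. \<exists>e\<in>D. comm e s = \<one> \<and> t = g [^] i \<otimes> e"
proof -
  interpret D: subgroup D G by fact
  interpret K: subgroup K G by fact
  have mult: "comm (a \<otimes> b) s = comm a s \<otimes> comm b s" if "a \<in> D" "b \<in> D" for a b
    using that s DK[OF that(1) s(2)[OF that(2)]] by (simp add: comm_mult_left comm_eq_one_iff)
  have pow: "comm (g [^] i) s = comm g s [^] i" for i :: nat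
    using g s(1) by (induction i) (simp_all add: mult D.nat_pow_mem)
  have K': "\<exists>i::nat. k = comm g s [^] i" if "k \<in> K" for k
    using prime_order_subgroup(2)[OF K p fin s(2)[OF g(1)] g(2) that] .
  show "\<exists>i::nat. \<exists>e\<in>D. comm e s = \<one> \<and> t = g [^] i \<otimes> e" if t: "t \<in> D"
  proof -
    obtain i :: nat where i: "comm t s = comm (g [^] i) s" using K' s(2)[OF t] pow by metis
    let ?e = "inv (g [^] i) \<otimes> t"
    have e: "?e \<in> D" using t g D.nat_pow_mem by simp
    have te: "t = g [^] i \<otimes> ?e" using t g by simp
    have "comm t s = comm (g [^] i) s \<otimes> comm ?e s"
      using mult[OF D.nat_pow_mem[OF g(1), of i] e] te by simp
    then have "comm t s \<otimes> comm ?e s = comm t s \<otimes> \<one>" using i t s(1) g(1) by simp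
    then have "comm ?e s = \<one>" using t e s(1) by (subst (asm) l_cancel) auto
    then show ?thesis using e te by blast
  qed
  interpret h: group_hom "G\<lparr>carrier := D\<rparr>" G "\<lambda>d. comm d s"
    using mult s(1) subgroup_imp_group[OF D] is_group
    by (auto simp: group_hom_def group_hom_axioms_def hom_def)
  have "(\<lambda>d. comm d s) ` D = K" using s(2) K' pow D.nat_pow_mem[OF g(1)] by (auto simp: image_iff) metis
  then show "card D = p * card {d \<in> D. comm d s = \<one>}"
    using h.order_eq_card_image_kernel K(2) fin finite_subset[OF D.subset]
    by (simp add: order_def kernel_def)
qed

text \<open>By \<open>comm_sym\<close>, exchanging the arguments inverts the commutator up to
  conjugation by an element of \<open>D\<close>, and \<open>D\<close> centralizes
  \<open>T\<close>.\<close>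

lemma comm_sym_mem:
  assumes "subgroup D G" "subgroup T G" "\<And>d t. d \<in> D \<Longrightarrow> t \<in> T \<Longrightarrow> comm d t = \<one>"
    and "x \<in> D" "y \<in> D" "comm x y \<in> T"
  shows "comm y x \<in> T"
proof -
  interpret D: subgroup D G by fact
  interpret T: subgroup T G by fact
  have "conjg (inv x \<otimes> y) (comm x y) = comm x y"
    using assms(3)[of "inv x \<otimes> y" "comm x y"] assms(4-) by (simp add: comm_eq_one_iff)
  then show ?thesis using assms(4-) by (simp add: comm_sym[of x y])
qed

text \<open>Commutators with values in \<open>T\<close> are multiplicative in the left argument,
  since \<open>D\<close> centralizes \<open>T\<close>. This passes from generators to
  \<open>D\<close> on the left, and \<open>comm_sym_mem\<close> exchanges the sides so that the
  argument can be repeated on the right.\<close>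

lemma derived_subset_of_generators:
  assumes D: "subgroup D G" "D = generate G A" and T: "subgroup T G"
    and DT: "\<And>d t. d \<in> D \<Longrightarrow> t \<in> T \<Longrightarrow> comm d t = \<one>"
    and A: "\<And>x y. x \<in> A \<Longrightarrow> y \<in> A \<Longrightarrow> comm x y \<in> T"
  shows "derived G D \<subseteq> T"
proof -
  interpret D: subgroup D G by fact
  interpret T: subgroup T G by fact
  have AD: "A \<subseteq> D" unfolding D(2) using generate.incl[of _ A G] by blast
  have sub: "comm d y \<in> T" if d: "d \<in> D" and y: "y \<in> D" "\<And>x. x \<in> A \<Longrightarrow> comm x y \<in> T" for d y
  proof -
    let ?N = "{d \<in> D. comm d y \<in> T}"
    have "subgroup ?N G"
    proof (rule subgroupI)
      fix a assume a: "a \<in> ?N"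
      have "comm (inv a) y = conjg (inv a) (inv (comm a y))"
        using a y by (simp add: comm_def conjg_def m_assoc inv_mult_group)
      also have "\<dots> = inv (comm a y)" using DT[of "inv a" "inv (comm a y)"] a y
        by (simp add: comm_eq_one_iff)
      finally show "inv a \<in> ?N" using a by simp
    next
      fix a b assume ab: "a \<in> ?N" "b \<in> ?N"
      then have "comm (a \<otimes> b) y = comm a y \<otimes> comm b y"
        using DT[of a "comm b y"] y by (simp add: comm_mult_left comm_eq_one_iff)
      then show "a \<otimes> b \<in> ?N" using ab by simp
    next
      have "\<one> \<in> ?N" using y by simp
      then show "?N \<noteq> {}" by blast
    qed auto
    then have "generate G A \<subseteq> ?N" using AD y(2) by (intro generate_subgroup_incl) auto
    then show ?thesis using d D(2) by blast
  qed
  have 1: "comm x d \<in> T" if "x \<in> A" "d \<in> D" for x d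
    using sub[of d x] A that AD comm_sym_mem[OF D(1) T DT, of d x] by blast
  have 2: "comm e d \<in> T" if "e \<in> D" "d \<in> D" for e d
    using sub[OF that] 1 that by blast
  have "rcomm g h = comm (inv h) g" if "g \<in> D" "h \<in> D" for g h
    using that by (simp add: comm_def rcomm_def conjg_def inv_mult_group m_assoc)
  then show ?thesis using 2 D.subset by (subst derived_subset_iff[OF T D.subset]) auto
qed

text \<open>Collecting all x on the left passes each of them over the earlier y. There are n choose
  2 such pairs, and each costs one factor z, which commutes with everything involved.\<close>

lemma pow_mult_class2_aux:
  assumes c: "x \<in> carrier G" "y \<in> carrier G" "z \<in> carrier G"
    and yx: "y \<otimes> x = x \<otimes> (y \<otimes> z)" and zx: "z \<otimes> x = x \<otimes> z" and zy: "z \<otimes> y = y \<otimes> z"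
  shows "(x \<otimes> y) [^] (n::nat) = x [^] n \<otimes> y [^] n \<otimes> z [^] (n choose 2)"
proof (induction n)
  case 0
  then show ?case by (simp add: binomial_eq_0)
next
  case (Suc n)
  have zn: "z [^] k \<otimes> x = x \<otimes> z [^] k" "z [^] k \<otimes> y = y \<otimes> z [^] k" for k :: nat
    using group_commutes_pow[OF zx c(3,1)] group_commutes_pow[OF zy c(3,2)] by auto
  have yn: "y [^] k \<otimes> x = x \<otimes> (y [^] k \<otimes> z [^] k)" for k :: nat
  proof (induction k)
    case (Suc k)
    have "y [^] Suc k \<otimes> x = y [^] k \<otimes> (x \<otimes> (y \<otimes> z))" using c yx by (simp add: m_assoc)
    also have "\<dots> = (y [^] k \<otimes> x) \<otimes> (y \<otimes> z)" using c by (simp add: m_assoc)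
    also have "\<dots> = x \<otimes> (y [^] k \<otimes> ((z [^] k \<otimes> y) \<otimes> z))" using c Suc by (simp add: m_assoc)
    also have "\<dots> = x \<otimes> (y [^] Suc k \<otimes> z [^] Suc k)" using c by (simp add: zn m_assoc)
    finally show ?case .
  qed (use c in simp)
  let ?b = "n choose 2"
  have "(x \<otimes> y) [^] Suc n = x [^] n \<otimes> (y [^] n \<otimes> ((z [^] ?b \<otimes> x) \<otimes> y))"
    using c Suc by (simp add: m_assoc)
  also have "\<dots> = x [^] n \<otimes> ((y [^] n \<otimes> x) \<otimes> (z [^] ?b \<otimes> y))"
    using c by (simp add: zn m_assoc)
  also have "\<dots> = x [^] n \<otimes> (x \<otimes> (y [^] n \<otimes> ((z [^] n \<otimes> (z [^] ?b \<otimes> y)))))"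
    using c by (simp add: yn m_assoc)
  also have "z [^] n \<otimes> (z [^] ?b \<otimes> y) = y \<otimes> (z [^] n \<otimes> z [^] ?b)"
  proof -
    have "z [^] n \<otimes> (z [^] ?b \<otimes> y) = (z [^] n \<otimes> y) \<otimes> z [^] ?b"
      unfolding zn(2)[of ?b] using c by (simp add: m_assoc)
    also have "\<dots> = (y \<otimes> z [^] n) \<otimes> z [^] ?b" by (simp only: zn)
    finally show ?thesis using c by (simp add: m_assoc)
  qed
  also have "x [^] n \<otimes> (x \<otimes> (y [^] n \<otimes> (y \<otimes> (z [^] n \<otimes> z [^] ?b))))
      = x [^] Suc n \<otimes> y [^] Suc n \<otimes> (z [^] n \<otimes> z [^] ?b)"
    using c by (simp add: m_assoc)
  also have "z [^] n \<otimes> z [^] ?b = z [^] (Suc n choose 2)"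
    using c by (simp add: nat_pow_mult numeral_2_eq_2)
  finally show ?case .
qed

text \<open>For odd p the number p choose 2 is a multiple of p, so the collected commutators cancel.
  This makes the power map an endomorphism.\<close>

lemma pow_mult_class2:
  assumes c: "x \<in> carrier G" "y \<in> carrier G" and p: "odd p"
    and z: "comm x (comm y x) = \<one>" "comm y (comm y x) = \<one>" "comm y x [^] p = \<one>"
  shows "(x \<otimes> y) [^] (p::nat) = x [^] p \<otimes> y [^] p"
proof -
  let ?z = "comm y x"
  have zc: "?z \<in> carrier G" using c by simp
  have com: "?z \<otimes> x = x \<otimes> ?z" "?z \<otimes> y = y \<otimes> ?z" using z c by (simp_all add: comm_eq_one_iff')
  have "y \<otimes> x = conjg y x \<otimes> y" using c by (simp add: conjg_def m_assoc)
  also have "\<dots> = x \<otimes> (?z \<otimes> y)" using c by (simp add: conjg_eq m_assoc)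
  finally have yx: "y \<otimes> x = x \<otimes> (y \<otimes> ?z)" using com by simp
  have "p choose 2 = p * ((p - 1) div 2)"
    using p by (auto simp: choose_two div_mult_swap)
  then have "?z [^] (p choose 2) = \<one>"
    using z(3) zc by (simp add: nat_pow_pow[symmetric] nat_pow_one)
  then show ?thesis using pow_mult_class2_aux[OF c zc yx com, of p] c by simp
qed

text \<open>\<open>centralizer_index\<close> is applied twice: in \<open>D\<close> to the
  centralizer of x, with y representing the cosets, and then inside that centralizer to the
  centralizer of y, with x representing the cosets.\<close>

lemma two_generators_mod_centralizer:
  assumes fin: "finite (carrier G)" and p: "Factorial_Ring.prime p"
    and D: "subgroup D G" and K: "subgroup K G" "card K = p"
    and DK: "\<And>d k. d \<in> D \<Longrightarrow> k \<in> K \<Longrightarrow> comm d k = \<one>"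
    and DD: "\<And>d e. d \<in> D \<Longrightarrow> e \<in> D \<Longrightarrow> comm d e \<in> K"
    and x: "x \<in> D" and y: "y \<in> D" and xy: "comm x y \<noteq> \<one>"
  defines "E \<equiv> {d \<in> D. comm d x = \<one> \<and> comm d y = \<one>}"
  shows "card D = p\<^sup>2 * card E" and "t \<in> D \<Longrightarrow> \<exists>(i::nat) (j::nat). \<exists>e\<in>E. t = y [^] i \<otimes> (x [^] j \<otimes> e)"
    and "subgroup E G"
proof -
  interpret D: subgroup D G by fact
  have c: "x \<in> carrier G" "y \<in> carrier G" using x y D.mem_carrier by auto
  have yx: "comm y x \<noteq> \<one>" using xy c by (simp add: comm_eq_one_iff')
  let ?C = "{d \<in> D. comm d x = \<one>}"
  have C: "subgroup ?C G" by (rule centralizer_subgroup[OF D c(1)])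
  have xC: "x \<in> ?C" using x c by (simp add: comm_eq_one_iff')
  note 1 = centralizer_index[OF fin p D K DK c(1) DD[OF _ x] y yx]
  have "card ?C = p * card {d \<in> ?C. comm d y = \<one>}"
    using C K DK DD y xC xy c by (intro centralizer_index(1)[OF fin p C]) auto
  moreover have E: "E = {d \<in> ?C. comm d y = \<one>}" by (auto simp: E_def)
  ultimately show "card D = p\<^sup>2 * card E" using 1(1) by (simp add: power2_eq_square)
  show "subgroup E G" unfolding E by (rule centralizer_subgroup[OF C c(2)])
  assume "t \<in> D"
  then obtain i :: nat and d where d: "d \<in> ?C" "t = y [^] i \<otimes> d" using 1(2) by blast
  have "\<exists>j::nat. \<exists>e\<in>?C. comm e y = \<one> \<and> d = x [^] j \<otimes> e"
    using C K DK DD y xC xy c d(1) by (intro centralizer_index(2)[OF fin p C]) auto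
  then obtain j :: nat and e where e: "e \<in> ?C" "comm e y = \<one>" "d = x [^] j \<otimes> e" by (elim exE bexE conjE)
  have "e \<in> E" using e by (simp add: E_def)
  moreover have "t = y [^] i \<otimes> (x [^] j \<otimes> e)" using d(2) e(3) by simp
  ultimately show "\<exists>(i::nat) (j::nat). \<exists>e\<in>E. t = y [^] i \<otimes> (x [^] j \<otimes> e)" by blast
qed

end

section \<open>The action on normal subgroups of order p and p^2\<close>

context p_group
begin

lemma normal_order_p_central:
  assumes "K \<lhd> G" "card K = p" "k \<in> K" "g \<in> carrier G"
  shows "comm g k = \<one>"
proof -
  have "comm g k \<in> {\<one>}"
    using assms subgroup.one_closed[OF normal_imp_subgroup[OF assms(1)]]
    by (intro central_section[OF one_is_normal, of K]) auto
  then show ?thesis by simp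
qed

text \<open>With a normal subgroup \<open>K\<close> of order p in \<open>S\<close>, commutators of
  \<open>G\<close> with \<open>S\<close> fall into \<open>K\<close> and those with \<open>K\<close>
  vanish. So all double commutators of s are trivial and \<open>comm_derived_mem\<close>
  applies.\<close>

lemma derived_centralizes_order_p2:
  assumes S: "S \<lhd> G" "card S = p\<^sup>2" "s \<in> S" and d: "d \<in> derived G (carrier G)"
  shows "comm d s = \<one>"
proof -
  interpret S: normal S G by fact
  have "\<exists>L. L \<lhd> G \<and> {\<one>} \<subseteq> L \<and> L \<subseteq> S \<and> card L = p ^ 1"
    using S(2) subgroup.one_closed[OF S.subgroup_axioms]
    by (intro normal_chain[OF one_is_normal _ S(1), of 0 2]) auto
  then obtain K where K: "K \<lhd> G" "K \<subseteq> S" "card K = p" by auto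
  have "comm d s \<in> {\<one>}"
  proof (rule normal.comm_derived_mem[OF one_is_normal _ _ d])
    fix g h assume gh: "g \<in> carrier G" "h \<in> carrier G"
    have "comm h s \<in> K"
      using K S gh by (intro central_section[OF K(1) S(1)]) (auto simp: power2_eq_square)
    then show "comm g (comm h s) \<in> {\<one>}" using normal_order_p_central[OF K(1,3)] gh by simp
  qed (use S(3) S.mem_carrier in blast)
  then show ?thesis by simp
qed

text \<open>\<open>G\<close> modulo the centralizer of \<open>S\<close> is cyclic of order \<open>p\<close>, so if all commutators of the form
  below were in \<open>N\<close>, then \<open>G\<close> modulo \<open>N\<close> would be abelian.\<close>

lemma commutator_with_centralizer:
  assumes S: "S \<lhd> G" "card S = p\<^sup>2" and K: "K \<lhd> G" "K \<subseteq> S" "card K = p"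
    and ncen: "\<exists>s\<in>S. \<exists>g\<in>carrier G. comm g s \<noteq> \<one>"
    and N: "N \<lhd> G" "\<not> derived G (carrier G) \<subseteq> N"
  shows "\<exists>g\<in>carrier G. \<exists>c\<in>carrier G.
    (\<forall>s\<in>S. comm c s = \<one>) \<and> (\<forall>s\<in>S - K. comm g s \<noteq> \<one>) \<and> rcomm g c \<notin> N"
proof -
  interpret S: normal S G by fact
  interpret K: normal K G by fact
  interpret N: normal N G by fact
  let ?q = "(#>) N"
  interpret Q: p_group "G Mod N" p by (rule p_group_quotient[OF N(1)])
  interpret q: group_hom G "G Mod N" "?q" by (rule N.quotient_hom)
  let ?C = "{c \<in> carrier G. \<forall>s\<in>S. comm c s = \<one>}"
  have cS: "card S = p * card K" using S(2) K(3) by (simp add: power2_eq_square)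
  have gK: "comm g k = \<one>" if "g \<in> carrier G" "k \<in> K" for g k
    using normal_order_p_central[OF K(1,3)] that by blast
  have gS: "comm g s \<in> K" if "g \<in> carrier G" "s \<in> S" for g s
    using central_section[OF K(1) S(1) K(2) cS] that by blast
  \<comment> \<open>\<open>S\<close> is generated by the central subgroup \<open>K\<close> and any
    element outside it, so centralizing one such element means centralizing
    \<open>S\<close>.\<close>
  have CI: "c \<in> ?C" if c: "c \<in> carrier G" and s: "s \<in> S" "s \<notin> K" and 1: "comm c s = \<one>" for c s
  proof -
    have "comm c t = \<one>" if t: "t \<in> S" for t
    proof -
      obtain i :: nat and k where t: "t = s [^] i \<otimes> k" and k: "k \<in> K"
        using K.prime_index_powers(2)[OF S.subgroup_axioms K(2) cS prime fin s t] by blast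
      have "conjg c k = k" "conjg c s = s" using gK[OF c k] 1 c k s by (simp_all add: comm_eq_one_iff)
      then show ?thesis using t c k s by (simp add: comm_eq_one_iff conjg_mult conjg_pow)
    qed
    then show ?thesis using c by simp
  qed
  obtain s1 g0 where s1: "s1 \<in> S" and g0: "g0 \<in> carrier G" and ne: "comm g0 s1 \<noteq> \<one>" using ncen by blast
  have s1K: "s1 \<notin> K" using gK[OF g0] ne by blast
  have g0C: "g0 \<notin> ?C" using s1 ne by blast
  have dec: "\<exists>i::nat. \<exists>e\<in>?C. t = g0 [^] i \<otimes> e" if t: "t \<in> carrier G" for t
  proof -
    have "\<exists>i::nat. \<exists>e\<in>carrier G. comm e s1 = \<one> \<and> t = g0 [^] i \<otimes> e"
      using gK gS s1 g0 ne t
      by (intro centralizer_index(2)[OF fin prime subgroup_self K.subgroup_axioms K(3)]) auto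
    then show ?thesis using CI[OF _ s1 s1K] by blast
  qed
  have C: "subgroup ?C G" by (rule normal_imp_subgroup[OF centralizer_normal[OF S(1)]])
  have iff: "rcomm a b \<in> N \<longleftrightarrow> ?q a \<otimes>\<^bsub>G Mod N\<^esub> ?q b = ?q b \<otimes>\<^bsub>G Mod N\<^esub> ?q a"
    if "a \<in> carrier G" "b \<in> carrier G" for a b
    using that N.coset_eq_one_iff[of "rcomm a b"]
    by (simp del: one_FactGroup mult_FactGroup add: q.hom_rcomm Q.rcomm_one_iff)
  have "\<exists>g\<in>carrier G. \<exists>c\<in>?C. g \<notin> ?C \<and> rcomm g c \<notin> N"
  proof (rule ccontr)
    assume "\<not> ?thesis"
    then have N': "rcomm g c \<in> N" if "g \<in> carrier G" "g \<notin> ?C" "c \<in> ?C" for g c using that by blast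
    have all: "rcomm t b \<in> N" if t: "t \<in> carrier G" and b: "b \<in> carrier G"
      and "rcomm g0 b \<in> N" and "\<And>e. e \<in> ?C \<Longrightarrow> rcomm e b \<in> N" for t b
    proof -
      obtain i :: nat and e where e: "e \<in> ?C" "t = g0 [^] i \<otimes> e" using dec[OF t] by blast
      have ec: "e \<in> carrier G" using e by blast
      have "?q g0 [^]\<^bsub>G Mod N\<^esub> i \<otimes>\<^bsub>G Mod N\<^esub> ?q b = ?q b \<otimes>\<^bsub>G Mod N\<^esub> ?q g0 [^]\<^bsub>G Mod N\<^esub> i"
        using that(3) g0 b by (intro Q.group_commutes_pow) (simp_all del: one_FactGroup mult_FactGroup add: iff)
      moreover have "?q e \<otimes>\<^bsub>G Mod N\<^esub> ?q b = ?q b \<otimes>\<^bsub>G Mod N\<^esub> ?q e"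
        using that(4)[OF e(1)] iff[OF ec b] by simp
      moreover have "?q t = ?q g0 [^]\<^bsub>G Mod N\<^esub> i \<otimes>\<^bsub>G Mod N\<^esub> ?q e"
        using e ec g0 by (simp del: one_FactGroup mult_FactGroup add: q.hom_nat_pow)
      ultimately have "?q t \<otimes>\<^bsub>G Mod N\<^esub> ?q b = ?q b \<otimes>\<^bsub>G Mod N\<^esub> ?q t"
        using ec g0 b q.hom_closed[OF ec] q.hom_closed[OF g0] q.hom_closed[OF b]
        by (metis Q.m_assoc Q.nat_pow_closed)
      then show ?thesis using iff[OF t b] by simp
    qed
    have sym: "rcomm b a \<in> N" if "rcomm a b \<in> N" "a \<in> carrier G" "b \<in> carrier G" for a b
      using that iff by simp
    have g0c: "rcomm g0 c \<in> N" if "c \<in> ?C" for c using N'[OF g0 g0C that] .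
    have CC: "rcomm d c \<in> N" if c: "c \<in> ?C" and d: "d \<in> ?C" for c d
    proof -
      have cc: "c \<in> carrier G" "d \<in> carrier G" using c d by auto
      \<comment> \<open>Both g0 and g0 d lie outside \<open>?C\<close>, so c commutes with both
        modulo \<open>N\<close> and hence with d. This trick brings in commutators inside
        \<open>?C\<close>, about which the assumption says nothing directly.\<close>
      have "g0 \<otimes> d \<notin> ?C"
      proof
        assume "g0 \<otimes> d \<in> ?C"
        then have "g0 \<otimes> d \<otimes> inv d \<in> ?C" using d C by (meson subgroup.m_closed subgroup.m_inv_closed)
        then show False using g0C g0 cc by (simp add: m_assoc)
      qed
      from N'[OF m_closed[OF g0 cc(2)] this c]
      have "?q g0 \<otimes>\<^bsub>G Mod N\<^esub> ?q d \<otimes>\<^bsub>G Mod N\<^esub> ?q c = ?q c \<otimes>\<^bsub>G Mod N\<^esub> (?q g0 \<otimes>\<^bsub>G Mod N\<^esub> ?q d)"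
        using iff[of "g0 \<otimes> d" c] g0 cc by (simp del: one_FactGroup mult_FactGroup)
      also have "\<dots> = ?q g0 \<otimes>\<^bsub>G Mod N\<^esub> (?q c \<otimes>\<^bsub>G Mod N\<^esub> ?q d)"
        using g0c[OF c] iff[OF g0 cc(1)] q.hom_closed[OF cc(1)] q.hom_closed[OF cc(2)] q.hom_closed[OF g0]
        by (metis Q.m_assoc)
      finally have "?q d \<otimes>\<^bsub>G Mod N\<^esub> ?q c = ?q c \<otimes>\<^bsub>G Mod N\<^esub> ?q d"
        using q.hom_closed[OF cc(1)] q.hom_closed[OF cc(2)] q.hom_closed[OF g0]
        by (metis Q.m_assoc Q.m_closed Q.l_cancel)
      then show ?thesis using iff cc by simp
    qed
    have 1: "rcomm t c \<in> N" if "t \<in> carrier G" "c \<in> ?C" for t c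
      using all[of t c] that g0c CC by blast
    have "rcomm g0 g0 \<in> N" using iff[OF g0 g0] by simp
    then have 2: "rcomm t g0 \<in> N" if "t \<in> carrier G" for t
      using all[OF that g0] g0 sym g0c by blast
    have "rcomm t b \<in> N" if "t \<in> carrier G" "b \<in> carrier G" for t b
      using all[OF that] 1 2 sym that g0 by blast
    then have "derived G (carrier G) \<subseteq> N"
      by (subst derived_subset_iff[OF N.subgroup_axioms]) auto
    then show False using N(2) by blast
  qed
  then obtain g c where gc: "g \<in> carrier G" "c \<in> ?C" "g \<notin> ?C" "rcomm g c \<notin> N" by blast
  have "comm g s \<noteq> \<one>" if "s \<in> S - K" for s using CI[of g s] gc that by blast
  then show ?thesis using gc by blast
qed

end

section \<open>The order of the second derived subgroup\<close>

context group
begin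

lemma carrier_normal: "carrier G \<lhd> G"
  by (rule normalI_conjg[OF subgroup_self]) auto

lemma comm_one_sym: "x \<in> carrier G \<Longrightarrow> y \<in> carrier G \<Longrightarrow> comm x y = \<one> \<Longrightarrow> comm y x = \<one>"
  by (simp add: comm_eq_one_iff')

lemma comm_self [simp]: "x \<in> carrier G \<Longrightarrow> comm x x = \<one>"
  by (simp add: comm_eq_one_iff')

lemma comm_mult_one:
  assumes "g \<in> carrier G" "x \<in> carrier G" "y \<in> carrier G" "comm g x = \<one>" "comm g y = \<one>"
  shows "comm g (x \<otimes> y) = \<one>"
  using assms by (simp add: comm_eq_one_iff conjg_mult)

lemma comm_pow_one: "g \<in> carrier G \<Longrightarrow> x \<in> carrier G \<Longrightarrow> comm g x = \<one> \<Longrightarrow> comm g (x [^] (n::nat)) = \<one>"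
  by (simp add: comm_eq_one_iff conjg_pow)

lemma comm_mult_left_one:
  assumes "g \<in> carrier G" "h \<in> carrier G" "x \<in> carrier G" "comm g x = \<one>" "comm h x = \<one>"
  shows "comm (g \<otimes> h) x = \<one>"
  using assms by (simp add: comm_eq_one_iff conjg_mult_left)

lemma comm_pow_left_one: "g \<in> carrier G \<Longrightarrow> x \<in> carrier G \<Longrightarrow> comm g x = \<one> \<Longrightarrow> comm (g [^] (n::nat)) x = \<one>"
  by (induction n) (simp_all add: comm_mult_left_one)

lemma center_normal:
  assumes "D \<lhd> G"
  shows "{z \<in> D. \<forall>d\<in>D. comm d z = \<one>} \<lhd> G" (is "?Z \<lhd> G")
proof -
  interpret D: normal D G by fact
  have "?Z = D \<inter> {g \<in> carrier G. \<forall>d\<in>D. comm g d = \<one>}"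
    using D.mem_carrier by (auto intro: comm_one_sym)
  then show ?thesis using normal_subgroup_intersect[OF assms centralizer_normal[OF assms]] by simp
qed

lemma derived_neq_oneE:
  assumes D: "subgroup D G" and ne: "card (derived G D) \<noteq> 1"
  obtains x y where "x \<in> D" "y \<in> D" "comm x y \<noteq> \<one>"
proof -
  interpret D: subgroup D G by fact
  have "\<one> \<in> derived G D" using subgroup.one_closed[OF derived_is_subgroup[OF D.subset]] .
  then have "\<not> derived G D \<subseteq> {\<one>}" using ne by (metis card_1_singleton_iff One_nat_def singletonD subset_singletonD empty_iff)
  then obtain a b where "a \<in> D" "b \<in> D" "rcomm a b \<noteq> \<one>"
    using derived_subset_iff[OF normal_imp_subgroup[OF one_is_normal] D.subset D.m_inv_closed] by blast
  then show thesis using that by (simp add: rcomm_one_iff comm_eq_one_iff')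
qed

text \<open>The commutator form on \<open>D\<close> modulo its radical is non-degenerate, and for these orders it has
  rank two, so the radical is the centralizer of any two non-commuting elements.\<close>

lemma class2_centralizer_central:
  assumes fin: "finite (carrier G)" and p: "Factorial_Ring.prime p"
    and D: "subgroup D G" and K: "K \<lhd> G" "card K = p" "K \<subseteq> D"
    and DK: "\<And>d k. d \<in> D \<Longrightarrow> k \<in> K \<Longrightarrow> comm d k = \<one>"
    and DD: "\<And>d e. d \<in> D \<Longrightarrow> e \<in> D \<Longrightarrow> comm d e \<in> K"
    and x: "x \<in> D" and y: "y \<in> D" and xy: "comm x y \<noteq> \<one>"
    and cD: "card D = p ^ 3 \<or> card D = p ^ 4"
    and e: "e \<in> D" "comm e x = \<one>" "comm e y = \<one>" and d: "d \<in> D"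
  shows "comm d e = \<one>"
proof -
  interpret D: subgroup D G by fact
  interpret K: normal K G by fact
  let ?E = "{d \<in> D. comm d x = \<one> \<and> comm d y = \<one>}"
  note two = two_generators_mod_centralizer[OF fin p D K.subgroup_axioms K(2) DK DD x y xy]
  have c: "x \<in> carrier G" "y \<in> carrier G" using x y by auto
  have p1: "p > 1" using prime_gt_1_nat[OF p] .
  have cE: "card ?E = card K \<or> card ?E = p * card K"
    using two(1) cD K(2) p1 by (elim disjE) (simp_all add: power2_eq_square power_numeral_reduce)
  have KE: "K \<subseteq> ?E"
  proof
    fix k assume k: "k \<in> K"
    then have "comm k x = \<one>" "comm k y = \<one>"
      using comm_one_sym[OF c(1) K.mem_carrier[OF k] DK[OF x k]]
        comm_one_sym[OF c(2) K.mem_carrier[OF k] DK[OF y k]] by simp_all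
    then show "k \<in> ?E" using k K(3) by blast
  qed
  have finE: "finite ?E" using fin D.subset by (auto intro: finite_subset)
  \<comment> \<open>\<open>?E\<close> is \<open>K\<close> itself or is generated by \<open>K\<close>
    and one further element; it is abelian in both cases.\<close>
  have EE: "comm a b = \<one>" if a: "a \<in> ?E" and b: "b \<in> ?E" for a b
  proof (cases "a \<in> K")
    case True
    have "b \<in> D" using b by simp
    then show ?thesis
      using comm_one_sym[OF D.mem_carrier K.mem_carrier[OF True] DK[OF _ True], of b] by simp
  next
    case False
    have cE': "card ?E = p * card K"
    proof (rule ccontr)
      assume "\<not> ?thesis"
      then have "K = ?E" using cE by (intro card_subset_eq[OF finE KE]) simp
      then show False using a False by simp
    qed
    then obtain i :: nat and k where k: "k \<in> K" "b = a [^] i \<otimes> k"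
      using K.prime_index_powers(2)[OF two(3) KE cE' p fin a False b] by blast
    then show ?thesis using DK[of a k] a by (simp add: comm_mult_one comm_pow_one)
  qed
  obtain i j :: nat and f where f: "f \<in> ?E" "d = y [^] i \<otimes> (x [^] j \<otimes> f)" using two(2) d by blast
  have ec: "e \<in> carrier G" using e by simp
  have "comm f e = \<one>" using EE[OF f(1)] e by simp
  moreover have "comm x e = \<one>" "comm y e = \<one>" using e c ec by (auto intro: comm_one_sym)
  ultimately show ?thesis using f c ec by (simp add: comm_mult_left_one comm_pow_left_one)
qed

lemma prime_order_pow_eq_one:
  assumes "subgroup K G" "card K = p" "Factorial_Ring.prime p" "finite (carrier G)" "k \<in> K"
  shows "k [^] p = \<one>"
  using prime_order_subgroup(1)[OF assms, of p] by (cases "k = \<one>") auto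

end

context p_group
begin

lemma ex_not_in_smaller: "subgroup N G \<Longrightarrow> card N < card L \<Longrightarrow> \<exists>x\<in>L. x \<notin> N"
  using card_mono[OF finite_subgroup, of N L] by (meson leD subsetI)

text \<open>Let \<open>W = D'\<close> for \<open>D = G'\<close>.  With a chief series \<open>D > A > B > W > K > 1\<close>, where
  \<open>A\<close> is the centralizer of \<open>B\<close> in \<open>D\<close>, and \<open>v \<in> A - B\<close>, choose
  \<open>g\<close> and \<open>c\<close> by \<open>commutator_with_centralizer\<close> with \<open>S = W\<close>.  For \<open>w = [g, c]\<close> the element
  \<open>comm g (comm w v)\<close> of \<open>K\<close> can be computed in two ways, with mutually inverse results.\<close>

lemma card_second_derived_neq_p2:
  assumes odd: "odd p"
    and D: "card (derived G (carrier G)) = p ^ 5"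
    and W: "card (derived G (derived G (carrier G))) = p\<^sup>2"
  shows False
proof -
  define D where "D = derived G (carrier G)"
  define W where "W = derived G D"
  have cD: "card D = p ^ 5" and cW: "card W = p\<^sup>2" using D W by (simp_all add: D_def W_def)
  have Dn: "D \<lhd> G" unfolding D_def by (rule derived_is_normal[OF carrier_normal])
  have Wn: "W \<lhd> G" unfolding W_def by (rule derived_is_normal[OF Dn])
  interpret D: normal D G by (rule Dn)
  interpret W: normal W G by (rule Wn)
  have WD: "W \<subseteq> D" unfolding W_def by (rule derived_incl[OF subset_refl D.subgroup_axioms])
  have Wc: "comm d w = \<one>" if "d \<in> D" "w \<in> W" for d w
    using derived_centralizes_order_p2[OF Wn cW] that by (simp add: D_def)
  have p1: "p > 1" using prime_gt_1_nat[OF prime] .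
  have "\<exists>L. L \<lhd> G \<and> {\<one>} \<subseteq> L \<and> L \<subseteq> W \<and> card L = p ^ 1"
    using subgroup.one_closed[OF W.subgroup_axioms]
    by (intro normal_chain[OF one_is_normal _ Wn cW, of 0]) auto
  then obtain K where Kn: "K \<lhd> G" and KW: "K \<subseteq> W" and cK: "card K = p" by auto
  interpret K: normal K G by (rule Kn)
  have "\<exists>L. L \<lhd> G \<and> W \<subseteq> L \<and> L \<subseteq> D \<and> card L = p ^ 3"
    by (rule normal_chain[OF Wn cW Dn cD WD]) auto
  then obtain B where Bn: "B \<lhd> G" and WB: "W \<subseteq> B" and BD: "B \<subseteq> D" and cB: "card B = p ^ 3" by auto
  interpret B: normal B G by (rule Bn)
  have cWK: "card W = p * card K" and cBW: "card B = p * card W"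
    using cW cK cB by (simp_all add: power2_eq_square power3_eq_cube)
  have BW: "comm g b \<in> W" if "g \<in> carrier G" "b \<in> B" for g b
    using central_section[OF Wn Bn WB cBW] that by blast
  have WK: "comm g w \<in> K" if "g \<in> carrier G" "w \<in> W" for g w
    using central_section[OF Kn Wn KW cWK] that by blast
  have Kc: "comm g k = \<one>" if "g \<in> carrier G" "k \<in> K" for g k
    using normal_order_p_central[OF Kn cK] that by blast
  \<comment> \<open>Commutation with \<open>G\<close> descends one step in \<open>B\<close> >
    \<open>W\<close> > \<open>K\<close>, so double commutators of b lie in \<open>K\<close> and the
    three subgroup lemma applies modulo \<open>K\<close>.\<close>
  have DB: "comm d b \<in> K" if d: "d \<in> D" and b: "b \<in> B" for d b
    using K.comm_derived_mem[OF B.mem_carrier[OF b] WK[OF _ BW[OF _ b]]] d unfolding D_def by blast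
  have Bdec: "\<exists>i::nat. \<exists>w\<in>W. b = u [^] i \<otimes> w" if "u \<in> B" "u \<notin> W" "b \<in> B" for u b
    using W.prime_index_powers(2)[OF B.subgroup_axioms WB cBW prime fin that] .
  have CB: "comm d b = \<one>" if d: "d \<in> D" and u: "u \<in> B" "u \<notin> W" "comm d u = \<one>" and b: "b \<in> B" for d u b
  proof -
    obtain i :: nat and w where "w \<in> W" "b = u [^] i \<otimes> w" using Bdec[OF u(1,2) b] by blast
    then show ?thesis using Wc[OF d] d u by (simp add: comm_mult_one comm_pow_one)
  qed
  have ltW: "card W < card B" using cBW cW p1 by simp
  obtain u0 where u0: "u0 \<in> B" "u0 \<notin> W"
    using ex_not_in_smaller[OF W.subgroup_axioms ltW] by (elim bexE)
  \<comment> \<open>If \<open>D\<close> centralized \<open>B\<close>, then, \<open>D\<close> being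
    generated by x, y and \<open>B\<close>, the group \<open>W\<close> would be generated by
    \<open>comm y x\<close>. The p-th power of x lies in \<open>B\<close> and so is fixed by y,
    which gives this commutator order at most p, too small for \<open>W\<close>.\<close>
  have "\<exists>w0\<in>D. comm w0 u0 \<noteq> \<one>"
  proof (rule ccontr)
    assume "\<not> ?thesis"
    then have Bc: "comm d b = \<one>" if "d \<in> D" "b \<in> B" for d b using that CB u0 by blast
    have "\<exists>L. L \<lhd> G \<and> B \<subseteq> L \<and> L \<subseteq> D \<and> card L = p ^ 4"
      by (rule normal_chain[OF Bn cB Dn cD BD]) auto
    then obtain M where Mn: "M \<lhd> G" and BM: "B \<subseteq> M" and MD: "M \<subseteq> D" and cM: "card M = p ^ 4" by auto
    interpret M: normal M G by (rule Mn)
    have cMB: "card M = p * card B" and cDM: "card D = p * card M"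
      using cM cB cD by (simp_all add: power_numeral_reduce)
    have lt: "card B < card M" "card M < card D" using cMB cDM cM cB p1 by simp_all
    obtain x where x: "x \<in> M" "x \<notin> B"
      using ex_not_in_smaller[OF B.subgroup_axioms lt(1)] by (elim bexE)
    obtain y where y: "y \<in> D" "y \<notin> M"
      using ex_not_in_smaller[OF M.subgroup_axioms lt(2)] by (elim bexE)
    have xD: "x \<in> D" using x MD by blast
    have c: "x \<in> carrier G" "y \<in> carrier G" using xD y by auto
    define z where "z = comm y x"
    have zW: "z \<in> W" unfolding z_def W_def by (rule comm_in_derived[OF D.subgroup_axioms y(1) xD])
    have zc: "z \<in> carrier G" using zW by simp
    have "x [^] p \<in> B" using B.prime_index_powers(1)[OF M.subgroup_axioms BM cMB prime fin x, of p] by simp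
    then have "conjg y (x [^] p) = x [^] p" using Bc[OF y(1)] c by (simp add: comm_eq_one_iff)
    moreover have "conjg y (x [^] p) = (x \<otimes> z) [^] p" using c by (simp add: conjg_pow conjg_eq[of y x] z_def)
    moreover have "x \<otimes> z = z \<otimes> x" using Wc[OF xD zW] c zc by (simp add: comm_eq_one_iff')
    ultimately have "x [^] p \<otimes> z [^] p = x [^] p \<otimes> \<one>" using c zc by (simp add: pow_mult_distrib)
    then have zp: "z [^] p = \<one>" using c zc by (subst (asm) l_cancel) auto
    let ?T = "generate G {z}"
    have T: "subgroup ?T G" using zc by (intro generate_is_subgroup) auto
    have "card ?T \<le> p" using zp pow_eq_id[OF zc, of p] generate_pow_card[OF zc] p1 by (simp add: dvd_imp_le)
    moreover have "W \<subseteq> ?T" unfolding W_def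
    proof (rule derived_subset_of_generators[OF D.subgroup_axioms _ T])
      show "D = generate G (insert x (insert y B))" (is "_ = ?S")
      proof
        have S: "subgroup ?S G" using c B.subset by (intro generate_is_subgroup) auto
        show "D \<subseteq> ?S"
        proof
          fix t assume "t \<in> D"
          then obtain i :: nat and m where m: "m \<in> M" "t = y [^] i \<otimes> m"
            using M.prime_index_powers(2)[OF D.subgroup_axioms MD cDM prime fin y] by blast
          obtain j :: nat and b where b: "b \<in> B" "m = x [^] j \<otimes> b"
            using B.prime_index_powers(2)[OF M.subgroup_axioms BM cMB prime fin x m(1)] by blast
          have "x \<in> ?S" "y \<in> ?S" "b \<in> ?S" using b by (auto intro: generate.incl)
          then show "t \<in> ?S" unfolding m(2) b(2) using S subgroup.nat_pow_mem[OF S]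
            by (intro subgroup.m_closed[OF S]) auto
        qed
        show "?S \<subseteq> D" using xD y BD by (intro generate_subgroup_incl[OF _ D.subgroup_axioms]) auto
      qed
      show Tc: "comm d t = \<one>" if d: "d \<in> D" and t: "t \<in> ?T" for d t
      proof -
        obtain k :: nat where "t = z [^] k" using t generate_pow_on_finite_carrier[OF fin zc] by blast
        then show ?thesis using Wc[OF d zW] d zc by (simp add: comm_pow_one)
      qed
      have yx: "comm y x \<in> ?T" unfolding z_def[symmetric] by (rule generate.incl) simp
      have xy: "comm x y \<in> ?T" by (rule comm_sym_mem[OF D.subgroup_axioms T Tc y(1) xD yx])
      have 1: "\<one> \<in> ?T" by (rule generate.one)
      have b1: "comm b d = \<one>" if "b \<in> B" "d \<in> D" for b d
        by (rule comm_one_sym[OF D.mem_carrier[OF that(2)] B.mem_carrier[OF that(1)] Bc[OF that(2,1)]])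
      have B1: "comm b d \<in> ?T" if "b \<in> B" "d \<in> D" for b d by (simp only: b1[OF that] 1)
      have B2: "comm d b \<in> ?T" if "d \<in> D" "b \<in> B" for b d by (simp only: Bc[OF that] 1)
      have xx: "comm x x \<in> ?T" "comm y y \<in> ?T" by (simp_all only: comm_self c 1)
      show "comm s t \<in> ?T" if "s \<in> insert x (insert y B)" "t \<in> insert x (insert y B)" for s t
        using that B1 B2 xx xy yx xD y(1) BD by blast
    qed
    ultimately have "p\<^sup>2 \<le> p"
      using card_mono[OF finite_subgroup[OF T] \<open>W \<subseteq> ?T\<close>] cW by linarith
    then show False using p1 by (simp add: power2_eq_square)
  qed
  then obtain w0 where w0: "w0 \<in> D" "comm w0 u0 \<noteq> \<one>" by blast
  \<comment> \<open>Commutation with the single element u0 maps \<open>D\<close> onto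
    \<open>K\<close>, which gives the index p. By \<open>CB\<close> the centralizer of u0 in
    \<open>D\<close> is that of \<open>B\<close>, which gives normality.\<close>
  define A where "A = {d \<in> D. comm d u0 = \<one>}"
  have KD: "comm d k = \<one>" if "d \<in> D" "k \<in> K" for d k using Kc that by simp
  have u0c: "u0 \<in> carrier G" using u0 by simp
  note ind = centralizer_index[OF fin prime D.subgroup_axioms K.subgroup_axioms cK KD u0c DB[OF _ u0(1)] w0]
  have cDA: "card D = p * card A" unfolding A_def by (rule ind(1))
  then have cA: "card A = p ^ 4" using cD p1 by (simp add: power_numeral_reduce)
  have AB: "comm a b = \<one>" if "a \<in> A" "b \<in> B" for a b
    using CB[OF _ u0] that by (auto simp: A_def)
  have "A = D \<inter> {g \<in> carrier G. \<forall>b\<in>B. comm g b = \<one>}"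
    using AB u0 D.subset by (auto simp: A_def)
  then have An: "A \<lhd> G" using normal_subgroup_intersect[OF Dn centralizer_normal[OF Bn]] by simp
  interpret A: normal A G by (rule An)
  have AD: "A \<subseteq> D" by (auto simp: A_def)
  have BA: "B \<subseteq> A"
  proof
    fix b assume b: "b \<in> B"
    have "comm u0 b = \<one>" using CB[of u0 u0 b] u0 b BD by auto
    then show "b \<in> A" using b BD u0c by (auto simp: A_def intro: comm_one_sym)
  qed
  have cAB: "card A = p * card B" using cA cB by (simp add: power_numeral_reduce)
  have ltB: "card B < card A" using cAB cB p1 by simp
  obtain v where v: "v \<in> A" "v \<notin> B"
    using ex_not_in_smaller[OF B.subgroup_axioms ltB] by (elim bexE)
  have vc: "v \<in> carrier G" using v by simp
  have Adec: "\<exists>i::nat. \<exists>b\<in>B. a = v [^] i \<otimes> b" if "a \<in> A" for a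
    using B.prime_index_powers(2)[OF A.subgroup_axioms BA cAB prime fin v that] .
  have va: "comm a v = \<one>" if a: "a \<in> A" for a
  proof -
    obtain i :: nat and b where "b \<in> B" "a = v [^] i \<otimes> b" using Adec[OF a] by blast
    then show ?thesis using AB[OF v(1)] vc
      by (simp add: comm_mult_left_one comm_pow_left_one comm_one_sym)
  qed
  have AA: "comm g v \<in> B" if "g \<in> carrier G" for g
    using central_section[OF Bn An BA cAB v(1) that] .
  have DA: "comm g d \<in> A" if "g \<in> carrier G" "d \<in> D" for g d
    using central_section[OF An Dn AD cDA that(2,1)] .
  have DvW: "comm d v \<in> W" if "d \<in> D" for d
    unfolding W_def using that v AD by (intro comm_in_derived[OF D.subgroup_axioms]) auto
  \<comment> \<open>\<open>D\<close> is generated by w0, v and \<open>B\<close>, and all other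
    commutators of these generators lie in \<open>K\<close>; if this one did too, \<open>W\<close>
    would be contained in \<open>K\<close>.\<close>
  have w0v: "comm w0 v \<notin> K"
  proof
    assume *: "comm w0 v \<in> K"
    have "W \<subseteq> K" unfolding W_def
    proof (rule derived_subset_of_generators[OF D.subgroup_axioms _ K.subgroup_axioms KD])
      show "D = generate G (insert w0 (insert v B))" (is "_ = ?S")
      proof
        have S: "subgroup ?S G" using w0 vc B.subset by (intro generate_is_subgroup) auto
        show "D \<subseteq> ?S"
        proof
          fix t assume "t \<in> D"
          then obtain i :: nat and m where m: "m \<in> A" "t = w0 [^] i \<otimes> m"
            using ind(2) unfolding A_def by blast
          obtain j :: nat and b where b: "b \<in> B" "m = v [^] j \<otimes> b" using Adec[OF m(1)] by blast
          have "w0 \<in> ?S" "v \<in> ?S" "b \<in> ?S" using b by (auto intro: generate.incl)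
          then show "t \<in> ?S" unfolding m(2) b(2) using S subgroup.nat_pow_mem[OF S]
            by (intro subgroup.m_closed[OF S]) auto
        qed
        show "?S \<subseteq> D" using w0 v AD BD by (intro generate_subgroup_incl[OF _ D.subgroup_axioms]) auto
      qed
      have vw: "comm v w0 \<in> K"
        by (rule comm_sym_mem[OF D.subgroup_axioms K.subgroup_axioms KD w0(1) subsetD[OF AD v(1)] *])
      have bd: "comm b d \<in> K" if "b \<in> B" "d \<in> D" for b d
        by (rule comm_sym_mem[OF D.subgroup_axioms K.subgroup_axioms KD that(2) subsetD[OF BD that(1)]
              DB[OF that(2,1)]])
      have xx: "comm v v \<in> K" "comm w0 w0 \<in> K" using vc w0(1) by simp_all
      show "comm s t \<in> K" if "s \<in> insert w0 (insert v B)" "t \<in> insert w0 (insert v B)" for s t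
        using that xx * vw bd DB w0(1) subsetD[OF AD v(1)] BD by blast
    qed auto
    then have "card W \<le> card K" by (rule card_mono[OF finite_subgroup[OF K.subgroup_axioms]])
    then show False using cWK cK p1 by simp
  qed
  define N where "N = {g \<in> carrier G. \<forall>b\<in>B. comm g b = \<one>}"
  have Nn: "N \<lhd> G" unfolding N_def by (rule centralizer_normal[OF Bn])
  \<comment> \<open>If \<open>W\<close> were central in \<open>G\<close>, all double commutators of
    u0 would vanish, and the three subgroup lemma would make \<open>D\<close> centralize u0.\<close>
  have ncen: "\<exists>s\<in>W. \<exists>g\<in>carrier G. comm g s \<noteq> \<one>"
  proof (rule ccontr)
    assume *: "\<not> ?thesis"
    have "comm w0 u0 \<in> {\<one>}"
      using w0(1) BW[OF _ u0(1)] * unfolding D_def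
      by (intro normal.comm_derived_mem[OF one_is_normal u0c]) blast+
    then show False using w0 by simp
  qed
  have DN: "\<not> derived G (carrier G) \<subseteq> N"
    using w0 u0 unfolding D_def[symmetric] N_def by blast
  obtain g c where g: "g \<in> carrier G" and c: "c \<in> carrier G" and cW1: "\<forall>s\<in>W. comm c s = \<one>"
    and gW: "\<forall>s\<in>W - K. comm g s \<noteq> \<one>" and gc: "rcomm g c \<notin> N"
    using commutator_with_centralizer[OF Wn cW Kn KW cK ncen Nn DN] by blast
  \<comment> \<open>Expand \<open>conjg h (conjg d v)\<close> directly and as
    \<open>conjg (conjg h d) (conjg h v)\<close>. In the second form the conjugate of d is d a with
    a in \<open>A\<close>, and a disappears because it centralizes both v and
    \<open>B\<close>.\<close>
  have swap: "comm h (comm d v) = comm d (comm h v)" if h: "h \<in> carrier G" and d: "d \<in> D" for h d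
  proof -
    define e m a where "e = comm d v" and "m = comm h v" and "a = comm h d"
    have e: "e \<in> W" and m: "m \<in> B" and a: "a \<in> A"
      using DvW[OF d] AA[OF h] DA[OF h d] by (auto simp: e_def m_def a_def)
    have cs: "e \<in> carrier G" "m \<in> carrier G" "a \<in> carrier G" "d \<in> carrier G"
      using e m a d by auto
    have em: "m \<otimes> x = x \<otimes> m" if "x \<in> W" for x
      using Wc[of m x] m BD that by (auto simp: comm_eq_one_iff' subset_iff)
    have ev: "v \<otimes> x = x \<otimes> v" if "x \<in> W" for x
      using Wc[of v x] v AD that by (auto simp: comm_eq_one_iff' subset_iff)
    have "conjg h (conjg d v) = conjg h v \<otimes> conjg h e"
      using h vc cs by (simp add: conjg_eq[of d v] conjg_mult flip: e_def)
    also have "\<dots> = v \<otimes> m \<otimes> (e \<otimes> comm h e)"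
      using h vc cs by (simp add: conjg_eq[of h v] conjg_eq[of h e] flip: m_def)
    finally have 1: "conjg h (conjg d v) = v \<otimes> m \<otimes> (e \<otimes> comm h e)" .
    have "conjg h (conjg d v) = conjg (conjg h d) (conjg h v)"
      using h cs vc by (simp add: conjg_def m_assoc inv_mult_group)
    also have "\<dots> = conjg d (conjg a (v \<otimes> m))"
      using h cs vc by (simp add: conjg_eq[of h d] conjg_eq[of h v] conjg_mult_left flip: m_def a_def)
    also have "conjg a (v \<otimes> m) = v \<otimes> m"
      using va[OF a] AB[OF a m] cs vc by (simp add: conjg_mult comm_eq_one_iff)
    also have "conjg d (v \<otimes> m) = v \<otimes> e \<otimes> (m \<otimes> comm d m)"
      using cs vc by (simp add: conjg_mult conjg_eq[of d v] conjg_eq[of d m] flip: e_def)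
    also have "\<dots> = v \<otimes> m \<otimes> (e \<otimes> comm d m)"
      using cs vc em[OF e] by (simp add: m_assoc) (simp flip: m_assoc)
    finally have "v \<otimes> m \<otimes> (e \<otimes> comm h e) = v \<otimes> m \<otimes> (e \<otimes> comm d m)" using 1 by simp
    then have "comm h e = comm d m" using cs vc h by simp
    then show ?thesis by (simp add: e_def m_def)
  qed
  define z where "z = comm c v"
  define u where "u = comm g v"
  have zB: "z \<in> B" and uB: "u \<in> B" using AA c g by (auto simp: z_def u_def)
  \<comment> \<open>c kills \<open>comm w0 v\<close>, which lies in \<open>W\<close>; by
    \<open>swap\<close> w0 then centralizes z. Outside \<open>W\<close> this would force w0 to
    centralize all of \<open>B\<close>.\<close>
  have zW: "z \<in> W"
  proof (rule ccontr)
    assume "z \<notin> W"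
    moreover have "comm w0 z = \<one>" using swap[OF c w0(1)] cW1 DvW[OF w0(1)] by (simp add: z_def)
    ultimately have "comm w0 u0 = \<one>" using CB[OF w0(1) zB] u0 by blast
    then show False using w0 by simp
  qed
  have uW: "u \<notin> W"
  proof
    assume "u \<in> W"
    then have "comm w0 u = \<one>" using Wc w0 by blast
    then have "comm g (comm w0 v) = \<one>" using swap[OF g w0(1)] by (simp add: u_def)
    then show False using gW DvW[OF w0(1)] w0v by blast
  qed
  define l y where "l = comm c u" and "y = comm g u"
  have lW: "l \<in> W" and yW: "y \<in> W" using BW uB c g by (auto simp: l_def y_def)
  define w where "w = rcomm g c"
  have wD: "w \<in> D" unfolding w_def D_def by (rule rcomm_in_derived[OF subgroup_self g c])
  have cs: "u \<in> carrier G" "z \<in> carrier G" "l \<in> carrier G" "y \<in> carrier G" "w \<in> carrier G"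
    using uB zB lW yW wD by auto
  have ly: "y \<otimes> l = l \<otimes> y" using Wc[of y l] WD yW lW cs by (auto simp: comm_eq_one_iff')
  have cy: "comm c y = \<one>" using cW1 yW by blast
  \<comment> \<open>For l in \<open>K\<close> the actions of g and c on u would commute, so w would
    centralize u, hence \<open>B\<close>, and lie in \<open>N\<close>.\<close>
  have lK: "l \<notin> K"
  proof
    assume "l \<in> K"
    then have "comm g l = \<one>" using Kc g by blast
    then have "comm w u = \<one>" unfolding w_def
      using cy ly g c cs by (intro comm_rcomm_eq_one) (auto simp flip: l_def y_def)
    then have "\<forall>b\<in>B. comm w b = \<one>" using CB[OF wD uB uW] by blast
    then show False using gc g c by (simp add: N_def w_def)
  qed
  define k where "k = comm g l"
  have kK: "k \<in> K" unfolding k_def by (rule WK[OF g lW])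
  have kc: "k \<in> carrier G" using kK by simp
  have kne: "k \<noteq> \<one>" using gW lW lK by (simp add: k_def)
  have Kcom: "x \<otimes> k' = k' \<otimes> x" if "x \<in> carrier G" "k' \<in> K" for x k'
    using Kc[OF that] that by (simp add: comm_eq_one_iff')
  have cjK: "conjg x k' = k'" if "x \<in> carrier G" "k' \<in> K" for x k'
    using Kc[OF that] that by (simp add: comm_eq_one_iff)
  have gcw: "g \<otimes> c = (c \<otimes> g) \<otimes> w" using g c by (simp add: w_def rcomm_def)
  \<comment> \<open>Applied to u, the products g c and c g differ only by \<open>comm g l\<close>,
    because c fixes y. This difference is the effect of w.\<close>
  have "comm w u = k"
  proof -
    have 1: "conjg (g \<otimes> c) u = u \<otimes> y \<otimes> (l \<otimes> k)"
      using g c cs by (simp add: conjg_mult_left conjg_mult conjg_eq[of c u] conjg_eq[of g u] conjg_eq[of g l]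
          flip: l_def y_def k_def)
    have 2: "conjg (c \<otimes> g) u = u \<otimes> l \<otimes> y"
      using g c cs cy by (simp add: conjg_mult_left conjg_mult conjg_eq[of c u] conjg_eq[of g u] conjg_eq[of c y]
          flip: l_def y_def)
    have wu: "comm w u \<in> K" by (rule DB[OF wD uB])
    have "conjg (g \<otimes> c) u = conjg (c \<otimes> g) (u \<otimes> comm w u)"
      unfolding gcw using g c cs by (simp add: conjg_mult_left conjg_eq[of w u])
    also have "\<dots> = u \<otimes> l \<otimes> y \<otimes> comm w u"
      using g c cs cjK[OF _ wu, of "c \<otimes> g"] by (simp add: conjg_mult 2)
    finally have "u \<otimes> l \<otimes> y \<otimes> comm w u = u \<otimes> l \<otimes> y \<otimes> k"
      unfolding 1 using ly cs kc by (simp add: m_assoc) (simp flip: m_assoc)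
    then show ?thesis using cs kc by simp
  qed
  define e where "e = comm w v"
  have eW: "e \<in> W" unfolding e_def by (rule DvW[OF wD])
  have ec: "e \<in> carrier G" using eW by simp
  have ge: "comm g e = k" using swap[OF g wD] \<open>comm w u = k\<close> by (simp add: e_def u_def)
  \<comment> \<open>The same comparison on v instead of u shows that l e lies in \<open>K\<close>:
    modulo \<open>K\<close>, e is the inverse of l.\<close>
  obtain k1 k2 where k1: "k1 \<in> K" and k2: "k2 \<in> K" and le: "k1 = l \<otimes> (e \<otimes> k2)"
  proof -
    have zu: "u \<otimes> z = z \<otimes> u" using Wc[of u z] uB BD zW cs by (auto simp: comm_eq_one_iff')
    have zg: "comm g z \<in> K" by (rule WK[OF g zW])
    have eg: "comm (c \<otimes> g) e \<in> K" using g c by (intro WK eW) auto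
    have kcs: "comm g z \<in> carrier G" "comm (c \<otimes> g) e \<in> carrier G" using zg eg by auto
    have 1: "conjg (g \<otimes> c) v = v \<otimes> u \<otimes> (z \<otimes> comm g z)"
      using g c cs vc by (simp add: conjg_mult_left conjg_mult conjg_eq[of c v] conjg_eq[of g v] conjg_eq[of g z]
          flip: u_def z_def)
    have 2: "conjg (c \<otimes> g) v = v \<otimes> z \<otimes> (u \<otimes> l)"
      using g c cs vc by (simp add: conjg_mult_left conjg_mult conjg_eq[of c v] conjg_eq[of g v] conjg_eq[of c u]
          flip: u_def z_def l_def)
    have "conjg (g \<otimes> c) v = conjg (c \<otimes> g) (v \<otimes> e)"
      unfolding gcw using g c cs vc by (simp add: conjg_mult_left conjg_eq[of w v] flip: e_def)
    also have "\<dots> = v \<otimes> z \<otimes> (u \<otimes> l) \<otimes> (e \<otimes> comm (c \<otimes> g) e)"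
      using g c cs vc ec by (simp add: conjg_mult 2 conjg_eq[of "c \<otimes> g" e])
    finally have "v \<otimes> (u \<otimes> z) \<otimes> comm g z = v \<otimes> (z \<otimes> u) \<otimes> (l \<otimes> (e \<otimes> comm (c \<otimes> g) e))"
      unfolding 1 using cs vc ec kcs by (simp add: m_assoc)
    then have "comm g z = l \<otimes> (e \<otimes> comm (c \<otimes> g) e)"
      unfolding zu using cs vc ec kcs by (simp add: m_assoc)
    then show thesis by (rule that[OF zg eg])
  qed
  have k12: "k1 \<in> carrier G" "k2 \<in> carrier G" using k1 k2 by auto
  \<comment> \<open>g fixes this element since it equals k1 in \<open>K\<close>, but g also
    multiplies each of l and e by the same k.\<close>
  have "l \<otimes> (e \<otimes> k2) = conjg g (l \<otimes> (e \<otimes> k2))" using cjK[OF g k1] by (simp flip: le)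
  also have "\<dots> = l \<otimes> k \<otimes> (e \<otimes> k \<otimes> k2)"
    using g cs ec k12 cjK[OF g k2] by (simp add: conjg_mult conjg_eq[of g l] conjg_eq[of g e] ge flip: k_def)
  also have "\<dots> = l \<otimes> (e \<otimes> k2) \<otimes> (k \<otimes> k)"
  proof -
    have "l \<otimes> k \<otimes> (e \<otimes> k \<otimes> k2) = l \<otimes> ((k \<otimes> e) \<otimes> (k \<otimes> k2))" using cs ec kc k12 by (simp add: m_assoc)
    also have "\<dots> = l \<otimes> ((e \<otimes> k) \<otimes> (k2 \<otimes> k))" using Kcom[OF ec kK] Kcom[OF k12(2) kK] by simp
    also have "\<dots> = l \<otimes> (e \<otimes> ((k \<otimes> k2) \<otimes> k))" using cs ec kc k12 by (simp add: m_assoc)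
    also have "\<dots> = l \<otimes> (e \<otimes> ((k2 \<otimes> k) \<otimes> k))" using Kcom[OF k12(2) kK] by simp
    finally show ?thesis using cs ec kc k12 by (simp add: m_assoc)
  qed
  finally have "l \<otimes> (e \<otimes> k2) \<otimes> \<one> = l \<otimes> (e \<otimes> k2) \<otimes> (k \<otimes> k)" using cs ec k12 by simp
  moreover define m where "m = l \<otimes> (e \<otimes> k2)"
  ultimately have "m \<otimes> \<one> = m \<otimes> (k \<otimes> k)" "m \<in> carrier G" using cs ec k12 by simp_all
  then have "k \<otimes> k = \<one>" using kc by simp
  then have "k [^] (2::nat) = \<one>" using kc by (simp add: numeral_2_eq_2)
  then have "p dvd 2" using prime_order_subgroup(1)[OF K.subgroup_axioms cK prime fin kK kne] by blast
  then show False using odd p1 by (auto dest: dvd_imp_le simp: numeral_2_eq_2 le_Suc_eq)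
qed

section \<open>The center and the power map of a derived subgroup of order p^4\<close>

lemma derived_subgroup_structure:
  assumes odd: "odd p"
    and D_def: "D = derived G (carrier G)" and cD: "card D = p ^ 4"
    and W_def: "W = derived G D" and cW: "card W = p"
    and Z_def: "Z = {z \<in> D. \<forall>d\<in>D. comm d z = \<one>}"
  shows "card Z = p\<^sup>2" and "z \<in> Z \<Longrightarrow> z [^] p = \<one>" and "x \<in> D \<Longrightarrow> x [^] p \<in> W"
proof -
  have Dn: "D \<lhd> G" unfolding D_def by (rule derived_is_normal[OF carrier_normal])
  have Wn: "W \<lhd> G" unfolding W_def by (rule derived_is_normal[OF Dn])
  interpret D: normal D G by (rule Dn)
  interpret W: normal W G by (rule Wn)
  have p1: "p > 1" using prime_gt_1_nat[OF prime] .
  have WD: "W \<subseteq> D" unfolding W_def by (rule derived_incl[OF subset_refl D.subgroup_axioms])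
  have Wc: "comm g w = \<one>" if "g \<in> carrier G" "w \<in> W" for g w
    using normal_order_p_central[OF Wn cW that(2,1)] .
  have DW: "comm d w = \<one>" if "d \<in> D" "w \<in> W" for d w using Wc that by simp
  have DD: "comm d e \<in> W" if "d \<in> D" "e \<in> D" for d e
    unfolding W_def using that by (rule comm_in_derived[OF D.subgroup_axioms])
  have Wp: "w [^] p = \<one>" if "w \<in> W" for w
    by (rule prime_order_pow_eq_one[OF W.subgroup_axioms cW prime fin that])
  have "card (derived G D) \<noteq> 1" using cW p1 by (simp flip: W_def)
  then obtain x0 y0 where xy: "x0 \<in> D" "y0 \<in> D" "comm x0 y0 \<noteq> \<one>"
    by (rule derived_neq_oneE[OF D.subgroup_axioms])
  have cs0: "x0 \<in> carrier G" "y0 \<in> carrier G" using xy by auto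
  let ?E = "{d \<in> D. comm d x0 = \<one> \<and> comm d y0 = \<one>}"
  have ZE: "Z = ?E"
  proof
    show "Z \<subseteq> ?E" using xy cs0 D.mem_carrier by (auto simp: Z_def intro: comm_one_sym)
    show "?E \<subseteq> Z"
    proof
      fix e assume e: "e \<in> ?E"
      then have "comm d e = \<one>" if "d \<in> D" for d
        using class2_centralizer_central[OF fin prime D.subgroup_axioms Wn cW WD DW DD xy _ _ _ _ that]
          cD by blast
      then show "e \<in> Z" using e by (simp add: Z_def)
    qed
  qed
  have "card D = p\<^sup>2 * card Z" unfolding ZE
    by (rule two_generators_mod_centralizer(1)[OF fin prime D.subgroup_axioms W.subgroup_axioms cW DW DD xy])
  then show cZ: "card Z = p\<^sup>2" using cD p1 by (simp add: power2_eq_square power_numeral_reduce)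
  have Zn: "Z \<lhd> G" unfolding Z_def by (rule center_normal[OF Dn])
  interpret Z: normal Z G by (rule Zn)
  have ZD: "Z \<subseteq> D" by (auto simp: Z_def)
  have WZ: "W \<subseteq> Z" using WD DW by (auto simp: Z_def)
  have DZ: "comm d z = \<one>" if "d \<in> D" "z \<in> Z" for d z using that by (simp add: Z_def)
  have pow: "(a \<otimes> b) [^] p = a [^] p \<otimes> b [^] p" if "a \<in> D" "b \<in> D" for a b
    using that DD DW Wp odd by (intro pow_mult_class2) auto
  \<comment> \<open>The power map is an endomorphism that kills \<open>W\<close>, so multiplying a
    by \<open>comm d a\<close> does not change its p-th power.\<close>
  have powZ: "a [^] p \<in> Z" if a: "a \<in> D" for a
  proof -
    have "comm d (a [^] p) = \<one>" if d: "d \<in> D" for d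
    proof -
      have "conjg d (a [^] p) = (a \<otimes> comm d a) [^] p" using a d by (simp add: conjg_pow conjg_eq[of d a])
      also have "\<dots> = a [^] p" using pow[OF a, of "comm d a"] Wp DD[OF d a] WD a by auto
      finally show ?thesis using a d by (simp add: comm_eq_one_iff)
    qed
    then show ?thesis using D.nat_pow_mem[OF a] by (simp add: Z_def)
  qed
  define U where "U = {a \<in> D. a [^] p = \<one>}"
  have Os: "subgroup U G"
  proof (rule subgroupI)
    fix a assume a: "a \<in> U"
    then show "inv a \<in> U" using D.mem_carrier by (simp add: U_def nat_pow_inv)
  next
    show "U \<noteq> {}" by (auto simp: U_def intro!: exI[of _ \<one>])
  qed (auto simp: U_def pow)
  have On: "U \<lhd> G"
    using D.conjg_mem by (intro normalI_conjg[OF Os]) (auto simp: U_def simp flip: conjg_pow)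
  \<comment> \<open>The image of the power map lies in \<open>Z\<close> and has at most p^2
    elements, so its kernel has at least p^2.\<close>
  have cO: "p\<^sup>2 \<le> card U"
  proof -
    interpret h: group_hom "G\<lparr>carrier := D\<rparr>" G "\<lambda>a. a [^] p"
      using pow subgroup_imp_group[OF D.subgroup_axioms] is_group
      by (auto simp: group_hom_def group_hom_axioms_def hom_def)
    have "card D = card ((\<lambda>a. a [^] p) ` D) * card U"
      using h.order_eq_card_image_kernel finite_subgroup[OF D.subgroup_axioms]
      by (simp add: order_def kernel_def U_def)
    moreover have "card ((\<lambda>a. a [^] p) ` D) \<le> p\<^sup>2"
      using cZ powZ by (metis card_mono finite_subgroup[OF Z.subgroup_axioms] image_subsetI)
    ultimately have "p ^ 4 \<le> p\<^sup>2 * card U" using cD by (metis mult_le_mono1)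
    then show ?thesis using p1 by (simp add: power2_eq_square power_numeral_reduce)
  qed
  obtain j where j: "card U = p ^ j" using card_subgroup[OF Os] by blast
  then have "2 \<le> j" using cO p1 by simp
  then have "\<exists>L. L \<lhd> G \<and> {\<one>} \<subseteq> L \<and> L \<subseteq> U \<and> card L = p\<^sup>2"
    using subgroup.one_closed[OF Os] by (intro normal_chain[OF one_is_normal _ On j, of 0]) auto
  then obtain L where L: "L \<lhd> G" "L \<subseteq> U" "card L = p\<^sup>2" by blast
  have "L \<subseteq> Z"
    using L derived_centralizes_order_p2[OF L(1,3)] by (auto simp: Z_def U_def D_def)
  then have "L = Z" using L(3) cZ finite_subgroup[OF Z.subgroup_axioms] by (intro card_subset_eq) auto
  then show Zp: "z [^] p = \<one>" if "z \<in> Z" for z using L(2) that by (auto simp: U_def)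
  have cZW: "card Z = p * card W" using cZ cW by (simp add: power2_eq_square)
  show "x [^] p \<in> W" if x: "x \<in> D"
  proof (rule ccontr)
    assume xW: "x [^] p \<notin> W"
    have xc: "x \<in> carrier G" using x by simp
    have "\<exists>L. L \<lhd> G \<and> Z \<subseteq> L \<and> L \<subseteq> D \<and> card L = p ^ 3"
      by (rule normal_chain[OF Zn cZ Dn cD ZD]) auto
    then obtain M where Mn: "M \<lhd> G" and ZM: "Z \<subseteq> M" and MD: "M \<subseteq> D" and cM: "card M = p ^ 3" by blast
    interpret M: normal M G by (rule Mn)
    have cMZ: "card M = p * card Z" and cDM: "card D = p * card M"
      using cM cZ cD by (simp_all add: power2_eq_square power_numeral_reduce)
    have MZ: "comm g m \<in> Z" if "g \<in> carrier G" "m \<in> M" for g m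
      using central_section[OF Zn Mn ZM cMZ that(2,1)] .
    have DM: "comm g d \<in> M" if "g \<in> carrier G" "d \<in> D" for g d
      using central_section[OF Mn Dn MD cDM that(2,1)] .
    have ZW: "comm g z \<in> W" if "g \<in> carrier G" "z \<in> Z" for g z
      using central_section[OF Wn Zn WZ cZW that(2,1)] .
    have Mdec: "\<exists>i::nat. \<exists>e\<in>Z. m = b [^] i \<otimes> e" if "b \<in> M" "b \<notin> Z" "m \<in> M" for b m
      using Z.prime_index_powers(2)[OF M.subgroup_axioms ZM cMZ prime fin that] .
    have lt: "card Z < card M" unfolding cZ cM using p1 by simp
    obtain m0 where m0: "m0 \<in> M" "m0 \<notin> Z"
      using ex_not_in_smaller[OF Z.subgroup_axioms lt] by (elim bexE)
    then obtain d0 where d0: "d0 \<in> D" "comm d0 m0 \<noteq> \<one>" using MD by (auto simp: Z_def)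
    have m0c: "m0 \<in> carrier G" using m0 by simp
    define N where "N = {g \<in> carrier G. \<forall>m\<in>M. comm g m = \<one>}"
    have Nn: "N \<lhd> G" unfolding N_def by (rule centralizer_normal[OF Mn])
    have DN: "\<not> derived G (carrier G) \<subseteq> N"
      using d0 m0 unfolding D_def[symmetric] N_def by blast
    have ncen: "\<exists>s\<in>Z. \<exists>g\<in>carrier G. comm g s \<noteq> \<one>"
    proof (rule ccontr)
      assume *: "\<not> ?thesis"
      have "comm d0 m0 \<in> {\<one>}"
        using d0(1) MZ[OF _ m0(1)] * unfolding D_def
        by (intro normal.comm_derived_mem[OF one_is_normal m0c]) blast+
      then show False using d0 by simp
    qed
    obtain g c where g: "g \<in> carrier G" and c: "c \<in> carrier G" and cZ1: "\<forall>s\<in>Z. comm c s = \<one>"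
      and gZ: "\<forall>s\<in>Z - W. comm g s \<noteq> \<one>" and gc: "rcomm g c \<notin> N"
      using commutator_with_centralizer[OF Zn cZ Wn WZ cW ncen Nn DN] by blast
    \<comment> \<open>The power map turns commutators with x into commutators with its p-th power: g
      and c move the latter by the p-th powers of b and z. As it lies in \<open>Z\<close> but not in
      \<open>W\<close>, g moves it and c does not.\<close>
    define z b where "z = comm c x" and "b = comm g x"
    have zM: "z \<in> M" and bM: "b \<in> M" using DM[OF _ x] c g by (auto simp: z_def b_def)
    have bD: "b \<in> D" and zD: "z \<in> D" using bM zM MD by auto
    have cs: "z \<in> carrier G" "b \<in> carrier G" using zM bM by auto
    have bp: "b [^] p \<noteq> \<one>"
    proof
      assume "b [^] p = \<one>"
      moreover have "conjg g (x [^] p) = (x \<otimes> b) [^] p"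
        using g xc by (simp add: conjg_pow conjg_eq[of g x] b_def)
      ultimately have "comm g (x [^] p) = \<one>" using pow[OF x bD] g xc by (simp add: comm_eq_one_iff)
      then show False using gZ powZ[OF x] xW by blast
    qed
    have bZ: "b \<notin> Z" using Zp bp by blast
    have zp: "z [^] p = \<one>"
    proof -
      have "conjg c (x [^] p) = (x \<otimes> z) [^] p"
        using c xc by (simp add: conjg_pow conjg_eq[of c x] z_def)
      moreover have "conjg c (x [^] p) = x [^] p" using cZ1 powZ[OF x] c xc by (simp flip: comm_eq_one_iff)
      ultimately have "x [^] p \<otimes> z [^] p = x [^] p \<otimes> \<one>" using pow[OF x zD] xc by simp
      then show ?thesis using xc cs by (subst (asm) l_cancel) auto
    qed
    \<comment> \<open>Otherwise z and \<open>Z\<close> would generate \<open>M\<close>, and b in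
      \<open>M\<close> would have trivial p-th power.\<close>
    have zZ: "z \<in> Z"
    proof (rule ccontr)
      assume zZ: "z \<notin> Z"
      obtain i :: nat and e where e: "e \<in> Z" "b = z [^] i \<otimes> e" using Mdec[OF zM zZ bM] by blast
      have "(z [^] i) [^] p = \<one>" using zp cs by (metis mult.commute nat_pow_one nat_pow_pow)
      then have "b [^] p = \<one>"
        using pow[OF D.nat_pow_mem[OF zD, of i] subsetD[OF ZD e(1)]] Zp[OF e(1)] e(2) by simp
      then show False using bp by simp
    qed
    define w where "w = rcomm g c"
    have wD: "w \<in> D" unfolding w_def D_def by (rule rcomm_in_derived[OF subgroup_self g c])
    have wc: "w \<in> carrier G" using wD by simp
    have gcw: "g \<otimes> c = (c \<otimes> g) \<otimes> w" using g c by (simp add: w_def rcomm_def)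
    \<comment> \<open>Applying g c = (c g) w to x, the factors b and z cancel because z is central
      in \<open>D\<close>. What remains expresses \<open>comm c b\<close> by \<open>comm g z\<close>
      and \<open>comm w x\<close>, both in \<open>W\<close>.\<close>
    have cbW: "comm c b \<in> W"
    proof -
      define e k where "e = comm w x" and "k = comm g z"
      have eW: "e \<in> W" and kW: "k \<in> W" using DD[OF wD x] ZW[OF g zZ] by (simp_all add: e_def k_def)
      have ek: "e \<in> carrier G" "k \<in> carrier G" using eW kW by auto
      have zb: "b \<otimes> z = z \<otimes> b" using DZ[OF bD zZ] cs by (simp add: comm_eq_one_iff')
      have "conjg (g \<otimes> c) x = x \<otimes> b \<otimes> (z \<otimes> k)"
        using g c cs xc by (simp add: conjg_mult_left conjg_mult conjg_eq[of c x] conjg_eq[of g x] conjg_eq[of g z]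
            flip: z_def b_def k_def)
      moreover have "conjg (g \<otimes> c) x = conjg (c \<otimes> g) x \<otimes> e"
        unfolding gcw using g c cs xc wc ek Wc[of "c \<otimes> g" e] eW
        by (simp add: conjg_mult_left[of _ w] conjg_eq[of w x] conjg_mult comm_eq_one_iff flip: e_def)
      moreover have "conjg (c \<otimes> g) x = x \<otimes> z \<otimes> (b \<otimes> comm c b)"
        using g c cs xc by (simp add: conjg_mult_left conjg_mult conjg_eq[of c x] conjg_eq[of g x] conjg_eq[of c b]
            flip: z_def b_def)
      ultimately have "x \<otimes> (b \<otimes> z) \<otimes> k = x \<otimes> (z \<otimes> b) \<otimes> (comm c b \<otimes> e)"
        using g c cs xc ek by (simp add: m_assoc)
      then have "k = comm c b \<otimes> e" unfolding zb using c cs xc ek by (simp add: m_assoc)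
      then have "comm c b = k \<otimes> inv e" using c cs ek by (simp add: m_assoc)
      then show ?thesis using eW kW by simp
    qed
    \<comment> \<open>b and \<open>Z\<close> generate \<open>M\<close>, so this makes w centralize
      \<open>M\<close>, against the choice of g and c.\<close>
    have "comm w b = \<one>" unfolding w_def
    proof (rule comm_rcomm_eq_one[OF cs(2) g c])
      show "comm g (comm c b) = \<one>" by (rule Wc[OF g cbW])
      show "comm c (comm g b) = \<one>" using cZ1 MZ[OF g bM] by blast
      show "comm g b \<otimes> comm c b = comm c b \<otimes> comm g b"
        using Wc[OF comm_closed[OF g cs(2)] cbW] g c cs by (simp add: comm_eq_one_iff')
    qed
    have "comm w m = \<one>" if m: "m \<in> M" for m
    proof -
      obtain i :: nat and e where "e \<in> Z" "m = b [^] i \<otimes> e" using Mdec[OF bM bZ m] by blast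
      then show ?thesis using \<open>comm w b = \<one>\<close> DZ[OF wD] wc cs
        by (simp add: comm_mult_one comm_pow_one)
    qed
    then show False using gc g c by (simp add: N_def w_def)
  qed
qed

end

section \<open>Groups of order \<open>p\<^sup>3\<close> and the decomposition of the derived subgroup\<close>

context group
begin

text \<open>Each of the a b exchanges of one x with one y produces one z.\<close>

lemma pow_commute_class2:
  assumes c: "x \<in> carrier G" "y \<in> carrier G" "z \<in> carrier G"
    and xy: "x \<otimes> y = y \<otimes> (x \<otimes> z)" and zx: "z \<otimes> x = x \<otimes> z" and zy: "z \<otimes> y = y \<otimes> z"
  shows "x [^] (a::nat) \<otimes> y [^] (b::nat) = y [^] b \<otimes> (x [^] a \<otimes> z [^] (a * b))"
proof -
  have zn: "z [^] k \<otimes> x = x \<otimes> z [^] k" "z [^] k \<otimes> y = y \<otimes> z [^] k" for k :: nat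
    using group_commutes_pow[OF zx c(3,1)] group_commutes_pow[OF zy c(3,2)] by auto
  have xa: "x [^] a \<otimes> y = y \<otimes> (x [^] a \<otimes> z [^] a)" for a :: nat
  proof (induction a)
    case (Suc a)
    have "x [^] Suc a \<otimes> y = (x [^] a \<otimes> y) \<otimes> (x \<otimes> z)" using c xy by (simp add: m_assoc)
    also have "\<dots> = y \<otimes> (x [^] a \<otimes> ((z [^] a \<otimes> x) \<otimes> z))" using c Suc by (simp add: m_assoc)
    also have "\<dots> = y \<otimes> (x [^] Suc a \<otimes> z [^] Suc a)" unfolding zn using c by (simp add: m_assoc)
    finally show ?case .
  qed (use c in simp)
  show ?thesis
  proof (induction b)
    case (Suc b)
    have "x [^] a \<otimes> y [^] Suc b = y [^] b \<otimes> (x [^] a \<otimes> (z [^] (a * b) \<otimes> y))"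
      using c Suc by (simp add: m_assoc flip: m_assoc[of "x [^] a" "y [^] b" y])
    also have "\<dots> = y [^] b \<otimes> ((x [^] a \<otimes> y) \<otimes> z [^] (a * b))" unfolding zn using c by (simp add: m_assoc)
    also have "\<dots> = y [^] Suc b \<otimes> (x [^] a \<otimes> (z [^] a \<otimes> z [^] (a * b)))"
      unfolding xa using c by (simp add: m_assoc)
    finally show ?case using c by (simp add: nat_pow_mult)
  qed (use c in simp)
qed

lemma pow_mod_eq:
  assumes "x \<in> carrier G" "x [^] p = \<one>"
  shows "x [^] (n mod p) = x [^] (n::nat)"
proof -
  have "x [^] n = x [^] (p * (n div p) + n mod p)" by simp
  also have "\<dots> = (x [^] p) [^] (n div p) \<otimes> x [^] (n mod p)"
    using assms(1) by (simp add: nat_pow_pow nat_pow_mult)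
  finally show ?thesis using assms by simp
qed

lemma not_comm_groupE:
  assumes "\<not> comm_group G"
  obtains x y where "x \<in> carrier G" "y \<in> carrier G" "comm x y \<noteq> \<one>"
  using assms group_comm_groupI by (metis comm_eq_one_iff')

end

lemma (in group) iso_of_surj_hom:
  assumes "group F" "h \<in> hom F G" "finite (carrier F)" "order F = order G"
    and "\<And>t. t \<in> carrier G \<Longrightarrow> \<exists>s\<in>carrier F. t = h s"
  shows "F \<cong> G"
proof -
  have im: "h ` carrier F = carrier G" using assms(2,5) by (auto simp: hom_def)
  then have "inj_on h (carrier F)"
    using assms(3,4) by (intro eq_card_imp_inj_on) (simp_all add: order_def)
  then show ?thesis using im assms(2) by (auto simp: is_iso_def iso_def bij_betw_def)
qed

lemma p_group_if_nonabelian_p3: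
  "nonabelian_p3_group p e G \<Longrightarrow> Factorial_Ring.prime p \<Longrightarrow> p_group G p"
  unfolding nonabelian_p3_group_def p_group_def p_group_axioms_def order_def
  by (auto intro: card_ge_0_finite simp: prime_gt_0_nat)

section \<open>Classification of the non-abelian groups of order p^3\<close>

context p_group
begin

text \<open>A normal subgroup \<open>M\<close> of order p^2 together with one element y generates
  the group. Commutators with elements of \<open>M\<close> lie in \<open>K\<close>, and y commutes
  with itself.\<close>

lemma order_p3_commutators:
  assumes "order G = p ^ 3"
  shows "\<exists>K. K \<lhd> G \<and> card K = p \<and> (\<forall>g\<in>carrier G. \<forall>h\<in>carrier G. comm g h \<in> K)"
proof -
  have cG: "card (carrier G) = p ^ 3" using assms by (simp add: order_def)
  have p1: "p > 1" using prime_gt_1_nat[OF prime] .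
  have "\<exists>L. L \<lhd> G \<and> {\<one>} \<subseteq> L \<and> L \<subseteq> carrier G \<and> card L = p ^ 1"
    by (intro normal_chain[OF one_is_normal _ carrier_normal cG, of 0]) auto
  then obtain K where K: "K \<lhd> G" "card K = p" by auto
  interpret K: normal K G by (rule K(1))
  have "\<exists>L. L \<lhd> G \<and> K \<subseteq> L \<and> L \<subseteq> carrier G \<and> card L = p ^ 2"
    using K(2) by (intro normal_chain[OF K(1) _ carrier_normal cG K.subset, of 1]) auto
  then obtain M where Mn: "M \<lhd> G" and KM: "K \<subseteq> M" and cM: "card M = p ^ 2" by auto
  interpret M: normal M G by (rule Mn)
  have cMK: "card M = p * card K" and cGM: "card (carrier G) = p * card M"
    using cM cG K(2) by (simp_all add: power2_eq_square power3_eq_cube)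
  have MK: "comm g m \<in> K" if "g \<in> carrier G" "m \<in> M" for g m
    using central_section[OF K(1) Mn KM cMK that(2,1)] .
  have Kc: "comm g k = \<one>" if "g \<in> carrier G" "k \<in> K" for g k
    using normal_order_p_central[OF K that(2,1)] .
  have lt: "card M < card (carrier G)" unfolding cM cG using p1 by simp
  obtain y where y: "y \<in> carrier G" "y \<notin> M"
    using ex_not_in_smaller[OF M.subgroup_axioms lt] by (elim bexE)
  have "derived G (carrier G) \<subseteq> K"
  proof (rule derived_subset_of_generators[OF subgroup_self _ K.subgroup_axioms Kc])
    show "carrier G = generate G (insert y M)" (is "_ = ?S")
    proof
      have S: "subgroup ?S G" using y M.subset by (intro generate_is_subgroup) auto
      show "carrier G \<subseteq> ?S"
      proof
        fix t assume "t \<in> carrier G"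
        then obtain i :: nat and m where m: "m \<in> M" "t = y [^] i \<otimes> m"
          using M.prime_index_powers(2)[OF subgroup_self M.subset cGM prime fin y] by blast
        have "y \<in> ?S" "m \<in> ?S" using m by (auto intro: generate.incl)
        then show "t \<in> ?S" unfolding m(2) using subgroup.nat_pow_mem[OF S]
          by (intro subgroup.m_closed[OF S]) auto
      qed
      show "?S \<subseteq> carrier G" using y M.subset by (intro generate_incl) auto
    qed
    have yy: "comm y y \<in> K" using y by simp
    have My: "comm m y \<in> K" if "m \<in> M" for m
      by (rule comm_sym_mem[OF subgroup_self K.subgroup_axioms Kc y(1) M.mem_carrier[OF that] MK[OF y(1) that]])
    show "comm s t \<in> K" if "s \<in> insert y M" "t \<in> insert y M" for s t
      using that yy My MK y(1) M.mem_carrier by blast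
  qed
  then have "comm g h \<in> K" if "g \<in> carrier G" "h \<in> carrier G" for g h
    using comm_in_derived[OF subgroup_self that] by blast
  with K show ?thesis by blast
qed

text \<open>The common centralizer of x and y has index p^2, hence order p, and it contains the
  central subgroup \<open>K\<close>.\<close>

lemma order_p3_decomposition:
  assumes G: "order G = p ^ 3" and K: "K \<lhd> G" "card K = p"
    and GK: "\<And>g h. g \<in> carrier G \<Longrightarrow> h \<in> carrier G \<Longrightarrow> comm g h \<in> K"
    and x: "x \<in> carrier G" and y: "y \<in> carrier G" and xy: "comm x y \<noteq> \<one>"
  shows "e \<in> carrier G \<Longrightarrow> comm e x = \<one> \<Longrightarrow> comm e y = \<one> \<Longrightarrow> e \<in> K"
    and "t \<in> carrier G \<Longrightarrow> \<exists>(i::nat) (j::nat). \<exists>k\<in>K. t = y [^] i \<otimes> (x [^] j \<otimes> k)"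
proof -
  interpret K: normal K G by (rule K(1))
  have Kc: "comm g k = \<one>" if "g \<in> carrier G" "k \<in> K" for g k
    using normal_order_p_central[OF K that(2,1)] .
  let ?E = "{d \<in> carrier G. comm d x = \<one> \<and> comm d y = \<one>}"
  note two = two_generators_mod_centralizer[OF fin prime subgroup_self K.subgroup_axioms K(2) Kc GK x y xy]
  have "card (carrier G) = p\<^sup>2 * card ?E" by (rule two(1))
  then have "card ?E = card K"
    using G K(2) prime_gt_1_nat[OF prime] by (simp add: order_def power2_eq_square power3_eq_cube)
  moreover have "K \<subseteq> ?E"
  proof
    fix k assume k: "k \<in> K"
    then have "comm k x = \<one>" "comm k y = \<one>"
      using comm_one_sym[OF x K.mem_carrier[OF k] Kc[OF x k]]
        comm_one_sym[OF y K.mem_carrier[OF k] Kc[OF y k]] by simp_all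
    then show "k \<in> ?E" using k K.subset by blast
  qed
  ultimately have E: "K = ?E" using fin by (intro card_subset_eq) simp_all
  show "e \<in> K" if "e \<in> carrier G" "comm e x = \<one>" "comm e y = \<one>"
    unfolding E using that by blast
  show "\<exists>(i::nat) (j::nat). \<exists>k\<in>K. t = y [^] i \<otimes> (x [^] j \<otimes> k)" if "t \<in> carrier G"
    unfolding E using two(2) that by blast
qed

lemma heis_iso:
  assumes G: "order G = p ^ 3" and nc: "\<not> comm_group G" and p3: "p \<ge> 3"
    and exp: "\<And>x. x \<in> carrier G \<Longrightarrow> x [^] p = \<one>"
  shows "heis p \<cong> G"
proof -
  obtain K where K: "K \<lhd> G" "card K = p"
    and GK: "\<And>g h. g \<in> carrier G \<Longrightarrow> h \<in> carrier G \<Longrightarrow> comm g h \<in> K"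
    using order_p3_commutators[OF G] by blast
  interpret K: normal K G by (rule K(1))
  obtain x y where x: "x \<in> carrier G" and y: "y \<in> carrier G" and xy: "comm x y \<noteq> \<one>"
    by (rule not_comm_groupE[OF nc])
  define z where "z = comm x y"
  have zK: "z \<in> K" unfolding z_def by (rule GK[OF x y])
  have z: "z \<in> carrier G" using zK by simp
  have zcom: "z \<otimes> t = t \<otimes> z" if "t \<in> carrier G" for t
    using normal_order_p_central[OF K zK that] that z by (simp add: comm_eq_one_iff')
  have zpow: "z [^] n \<otimes> t = t \<otimes> z [^] n" if "t \<in> carrier G" for t and n :: nat
    using group_commutes_pow[OF zcom[OF that] z that] .
  have "x \<otimes> y = conjg x y \<otimes> x" using x y by (simp add: conjg_def m_assoc)
  also have "\<dots> = y \<otimes> (z \<otimes> x)" using x y by (simp add: conjg_eq m_assoc z_def)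
  finally have com: "x \<otimes> y = y \<otimes> (x \<otimes> z)" using zcom[OF x] by simp
  note xy_pow = pow_commute_class2[OF x y z com zcom[OF x] zcom[OF y]]
  \<comment> \<open>The order of the factors follows the multiplication of \<open>heis\<close>:
    moving a power x^a past y^b' creates z^(a b'), its term \<open>a * b'\<close>.\<close>
  let ?f = "\<lambda>(a, b, c). y [^] nat b \<otimes> (x [^] nat a \<otimes> z [^] nat c)"
  note hp = heis_nonabelian_p3[OF prime p3]
  show ?thesis
  proof (rule iso_of_surj_hom[where h = ?f])
    show "group (heis p)" using hp by (simp add: nonabelian_p3_group_def)
    show "finite (carrier (heis p))" by (simp add: heis_def)
    show "order (heis p) = order G" using hp G by (simp add: nonabelian_p3_group_def)
    show "?f \<in> hom (heis p) G"
    proof (rule homI)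
      fix s assume "s \<in> carrier (heis p)"
      show "?f s \<in> carrier G" using x y z by (auto split: prod.split)
    next
      fix s t assume "s \<in> carrier (heis p)" "t \<in> carrier (heis p)"
      then obtain a b c a' b' c' :: nat where s: "s = (int a, int b, int c)" and t: "t = (int a', int b', int c')"
        by (cases s; cases t) (auto simp: heis_def elim!: nonneg_int_cases)
      have st: "s \<otimes>\<^bsub>heis p\<^esub> t = (int ((a + a') mod p), int ((b + b') mod p), int ((c + c' + a * b') mod p))"
        by (simp add: s t heis_def zmod_int)
      have "?f s \<otimes> ?f t = y [^] b \<otimes> (x [^] a \<otimes> ((z [^] c \<otimes> y [^] b') \<otimes> (x [^] a' \<otimes> z [^] c')))"
        using x y z by (simp add: s t m_assoc)
      also have "\<dots> = y [^] b \<otimes> ((x [^] a \<otimes> y [^] b') \<otimes> ((z [^] c \<otimes> x [^] a') \<otimes> z [^] c'))"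
        unfolding zpow[OF nat_pow_closed[OF y]] using x y z by (simp add: m_assoc)
      also have "\<dots> = y [^] b \<otimes> (y [^] b' \<otimes> (x [^] a \<otimes> (z [^] (a * b') \<otimes> (x [^] a' \<otimes> (z [^] c \<otimes> z [^] c')))))"
        unfolding zpow[OF nat_pow_closed[OF x]] xy_pow using x y z by (simp add: m_assoc)
      also have "\<dots> = y [^] b \<otimes> (y [^] b' \<otimes> (x [^] a \<otimes> ((z [^] (a * b') \<otimes> x [^] a') \<otimes> (z [^] c \<otimes> z [^] c'))))"
        using x y z by (simp add: m_assoc)
      also have "\<dots> = y [^] (b + b') \<otimes> (x [^] (a + a') \<otimes> z [^] (a * b' + (c + c')))"
        unfolding zpow[OF nat_pow_closed[OF x]] using x y z
        by (simp add: m_assoc flip: nat_pow_mult)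
      also have "a * b' + (c + c') = c + c' + a * b'" by simp
      finally show "?f (s \<otimes>\<^bsub>heis p\<^esub> t) = ?f s \<otimes> ?f t"
        using x y z by (simp add: st pow_mod_eq exp)
    qed
    fix t assume "t \<in> carrier G"
    then obtain i j :: nat and k where k: "k \<in> K" "t = y [^] i \<otimes> (x [^] j \<otimes> k)"
      using order_p3_decomposition(2)[OF G K GK x y xy] by blast
    obtain l :: nat where l: "k = z [^] l"
      using prime_order_subgroup(2)[OF K.subgroup_axioms K(2) prime fin zK _ k(1)] xy by (auto simp: z_def)
    have "?f (int (j mod p), int (i mod p), int (l mod p)) = t"
      using x y z by (simp add: k l pow_mod_eq exp)
    moreover have "(int (j mod p), int (i mod p), int (l mod p)) \<in> carrier (heis p)"
      using p3 by (simp add: heis_def)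
    ultimately show "\<exists>s\<in>carrier (heis p). t = ?f s" by metis
  qed
qed

text \<open>All p-th powers lie in \<open>K\<close>, which is generated by the p-th power z of an
  element x of order p^2. An element that does not commute with x can be changed to y of order p
  with \<open>comm y x\<close> equal to z, so that y acts on x as raising to the power 1 + p, as in
  \<open>modular\<close>.\<close>

lemma modular_iso:
  assumes G: "order G = p ^ 3" and nc: "\<not> comm_group G" and p3: "p \<ge> 3"
    and exp: "\<exists>x\<in>carrier G. x [^] p \<noteq> \<one>"
  shows "modular p \<cong> G"
proof -
  have odd: "odd p" using prime p3 prime_odd_nat[of p] by auto
  obtain K where K: "K \<lhd> G" "card K = p"
    and GK: "\<And>g h. g \<in> carrier G \<Longrightarrow> h \<in> carrier G \<Longrightarrow> comm g h \<in> K"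
    using order_p3_commutators[OF G] by blast
  interpret K: normal K G by (rule K(1))
  have Kc: "comm g k = \<one>" if "g \<in> carrier G" "k \<in> K" for g k
    using normal_order_p_central[OF K that(2,1)] .
  have Kp: "k [^] p = \<one>" if "k \<in> K" for k
    by (rule prime_order_pow_eq_one[OF K.subgroup_axioms K(2) prime fin that])
  have pow: "(a \<otimes> b) [^] p = a [^] p \<otimes> b [^] p" if "a \<in> carrier G" "b \<in> carrier G" for a b
    using that GK Kc Kp odd by (intro pow_mult_class2) auto
  obtain x1 y1 where xy1: "x1 \<in> carrier G" "y1 \<in> carrier G" "comm x1 y1 \<noteq> \<one>"
    by (rule not_comm_groupE[OF nc])
  have cen: "e \<in> K" if "e \<in> carrier G" "\<And>g. g \<in> carrier G \<Longrightarrow> comm g e = \<one>" for e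
    by (rule order_p3_decomposition(1)[OF G K GK xy1 that(1)
          comm_one_sym[OF xy1(1) that(1) that(2)[OF xy1(1)]] comm_one_sym[OF xy1(2) that(1) that(2)[OF xy1(2)]]])
  have powK: "a [^] p \<in> K" if a: "a \<in> carrier G" for a
  proof (rule cen)
    fix g assume g: "g \<in> carrier G"
    have "conjg g (a [^] p) = (a \<otimes> comm g a) [^] p" using a g by (simp add: conjg_pow conjg_eq[of g a])
    also have "\<dots> = a [^] p" using pow[OF a, of "comm g a"] Kp GK[OF g a] a g by simp
    finally show "comm g (a [^] p) = \<one>" using a g by (simp add: comm_eq_one_iff)
  qed (use a in simp)
  obtain x where x: "x \<in> carrier G" and xp: "x [^] p \<noteq> \<one>" using exp by blast
  define z where "z = x [^] p"
  have zK: "z \<in> K" and z1: "z \<noteq> \<one>" using powK[OF x] xp by (simp_all add: z_def)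
  have z: "z \<in> carrier G" using zK by simp
  note Kz = prime_order_subgroup(2)[OF K.subgroup_axioms K(2) prime fin zK z1]
  have "\<not> (\<forall>g\<in>carrier G. comm g x = \<one>)" using cen[OF x] Kp xp by blast
  then obtain g where g: "g \<in> carrier G" "comm g x \<noteq> \<one>" by blast
  \<comment> \<open>This power of x cancels the p-th power of g, and multiplying by it does not
    affect the commutator with x.\<close>
  obtain n :: nat where n: "inv (g [^] p) = z [^] n" using Kz powK[OF g(1)] K.m_inv_closed by blast
  define h where "h = g \<otimes> x [^] n"
  have h: "h \<in> carrier G" using g x by (simp add: h_def)
  have hp: "h [^] p = \<one>"
  proof -
    have "(x [^] n) [^] p = z [^] n" using x by (simp add: z_def nat_pow_pow mult.commute)
    then have "h [^] p = g [^] p \<otimes> inv (g [^] p)" using pow[of g "x [^] n"] g x n by (simp add: h_def)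
    then show ?thesis using g by simp
  qed
  have "comm h x = comm g x"
    using g x by (simp add: h_def comm_mult_left comm_pow_left_one)
  then have hK: "comm h x \<in> K" "comm h x \<noteq> \<one>" using g GK[OF h x] by simp_all
  \<comment> \<open>\<open>comm h x\<close> generates \<open>K\<close>, and commutation with x is
    multiplicative on powers of h, so a power of h has commutator exactly z.\<close>
  obtain s :: nat where s: "z = comm h x [^] s"
    using prime_order_subgroup(2)[OF K.subgroup_axioms K(2) prime fin hK zK] by blast
  define y where "y = h [^] s"
  have y: "y \<in> carrier G" using h by (simp add: y_def)
  have yp: "y [^] p = \<one>"
    using h hp by (metis mult.commute nat_pow_one nat_pow_pow y_def)
  have "comm (h [^] n) x = comm h x [^] n" for n :: nat
  proof (induction n)
    case (Suc n)
    have "conjg (h [^] n) (comm h x) = comm h x" using Kc[OF _ hK(1)] h x by (simp flip: comm_eq_one_iff)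
    then show ?case using Suc h x by (simp add: comm_mult_left)
  qed (use x in simp)
  then have yx: "comm y x = z" using s by (simp add: y_def)
  have zcom: "z \<otimes> t = t \<otimes> z" if "t \<in> carrier G" for t
    using Kc[OF that zK] that z by (simp add: comm_eq_one_iff')
  have zpow: "z [^] n \<otimes> t = t \<otimes> z [^] n" if "t \<in> carrier G" for t and n :: nat
    using group_commutes_pow[OF zcom[OF that] z that] .
  have "y \<otimes> x = conjg y x \<otimes> y" using x y by (simp add: conjg_def m_assoc)
  also have "\<dots> = x \<otimes> (z \<otimes> y)" using x y z by (simp add: conjg_eq m_assoc yx)
  finally have com: "y \<otimes> x = x \<otimes> (y \<otimes> z)" using zcom[OF y] by simp
  have yx_pow: "y [^] b \<otimes> x [^] a = x [^] (a + p * (b * a)) \<otimes> y [^] b" for a b :: nat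
  proof -
    have "y [^] b \<otimes> x [^] a = x [^] a \<otimes> (z [^] (b * a) \<otimes> y [^] b)"
      unfolding pow_commute_class2[OF y x z com zcom[OF y] zcom[OF x]]
        zpow[OF nat_pow_closed[OF y]] ..
    also have "z [^] (b * a) = x [^] (p * (b * a))" using x by (simp add: z_def nat_pow_pow)
    finally show ?thesis using x y by (simp add: nat_pow_mult flip: m_assoc)
  qed
  have xpp: "x [^] (p * p) = \<one>" using Kp[OF zK] x by (simp add: z_def nat_pow_pow)
  let ?f = "\<lambda>(a, b). x [^] nat a \<otimes> y [^] nat b"
  note mp = modular_nonabelian_p3[OF prime p3]
  show ?thesis
  proof (rule iso_of_surj_hom[where h = ?f])
    show "group (modular p)" using mp by (simp add: nonabelian_p3_group_def)
    show "finite (carrier (modular p))" by (simp add: modular_def)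
    show "order (modular p) = order G" using mp G by (simp add: nonabelian_p3_group_def)
    show "?f \<in> hom (modular p) G"
    proof (rule homI)
      fix s assume "s \<in> carrier (modular p)"
      show "?f s \<in> carrier G" using x y by (auto split: prod.split)
    next
      fix s t assume "s \<in> carrier (modular p)" "t \<in> carrier (modular p)"
      then obtain a b a' b' :: nat where s: "s = (int a, int b)" and t: "t = (int a', int b')"
        by (cases s; cases t) (auto simp: modular_def elim!: nonneg_int_cases)
      have st: "s \<otimes>\<^bsub>modular p\<^esub> t = (int ((a + a' + p * (b * a')) mod (p * p)), int ((b + b') mod p))"
        by (simp add: s t modular_def zmod_int)
      have "?f s \<otimes> ?f t = x [^] a \<otimes> ((y [^] b \<otimes> x [^] a') \<otimes> y [^] b')"
        using x y by (simp add: s t m_assoc)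
      also have "\<dots> = x [^] (a + a' + p * (b * a')) \<otimes> y [^] (b + b')"
        unfolding yx_pow using x y by (simp add: m_assoc flip: nat_pow_mult)
      finally show "?f (s \<otimes>\<^bsub>modular p\<^esub> t) = ?f s \<otimes> ?f t"
        using x y by (simp add: st pow_mod_eq yp xpp)
    qed
    fix t assume "t \<in> carrier G"
    moreover have "comm x y \<noteq> \<one>" using yx z1 comm_one_sym[OF x y] by auto
    ultimately obtain i j :: nat and k where k: "k \<in> K" "t = y [^] i \<otimes> (x [^] j \<otimes> k)"
      using order_p3_decomposition(2)[OF G K GK x y] by blast
    obtain l :: nat where l: "k = z [^] l" using Kz[OF k(1)] by blast
    have "t = y [^] i \<otimes> x [^] (j + p * l)"
      using x y by (simp add: k l z_def nat_pow_pow nat_pow_mult)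
    \<comment> \<open>The exponent arises from moving y^i to the right past x^(j + p l) by
      \<open>yx_pow\<close>.\<close>
    then have "?f (int ((j + p * l + p * (i * (j + p * l))) mod (p * p)), int (i mod p)) = t"
      unfolding yx_pow using x y by (simp add: pow_mod_eq yp xpp)
    moreover have "(int ((j + p * l + p * (i * (j + p * l))) mod (p * p)), int (i mod p)) \<in> carrier (modular p)"
      using p3 by (simp add: modular_def flip: of_nat_mult)
    ultimately show "\<exists>s\<in>carrier (modular p). t = ?f s" by metis
  qed
qed

end

section \<open>A direct complement in the derived subgroup\<close>

lemma (in group) finite_subgroupI:
  assumes fin: "finite (carrier G)" and S: "S \<subseteq> carrier G" "S \<noteq> {}"
    and mult: "\<And>a b. a \<in> S \<Longrightarrow> b \<in> S \<Longrightarrow> a \<otimes> b \<in> S"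
  shows "subgroup S G"
proof (rule subgroupI[OF S])
  fix a assume a: "a \<in> S"
  then have c: "a \<in> carrier G" using S by blast
  have pow: "a [^] Suc n \<in> S" for n using a mult c S by (induction n) auto
  let ?n = "order G"
  have n: "?n > 0" using fin order_gt_0_iff_finite by simp
  \<comment> \<open>With twice the order, the exponent of the inverse stays positive even in the
    trivial group, so only closure under products is used.\<close>
  have "a [^] (2 * ?n) = \<one>" using pow_order_eq_1[OF c] c by (simp add: mult.commute flip: nat_pow_pow)
  moreover have "2 * ?n = Suc (Suc (2 * ?n - 2))" using n by simp
  ultimately have "a [^] Suc (2 * ?n - 2) \<otimes> a = \<one>" by (metis nat_pow_Suc)
  then have "inv a = a [^] Suc (2 * ?n - 2)" using c by (intro inv_equality) auto
  then show "inv a \<in> S" using pow by simp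
qed (use mult in blast)

context p_group
begin

text \<open>The complement of \<open>\<langle>u\<rangle>\<close> for \<open>u \<in> Z(D) - D'\<close> is generated by \<open>D'\<close> and two
  non-commuting elements.\<close>

lemma derived_subgroup_direct_factor:
  assumes odd: "odd p"
    and D_def: "D = derived G (carrier G)" and cD: "card D = p ^ 4"
    and W_def: "W = derived G D" and cW: "card W = p"
  shows "\<exists>H. subgroup H G \<and> card H = p ^ 3 \<and> \<not> comm_group (G\<lparr>carrier := H\<rparr>) \<and>
    G\<lparr>carrier := D\<rparr> \<cong> G\<lparr>carrier := H\<rparr> \<times>\<times> integer_mod_group p"
proof -
  define Z where "Z = {z \<in> D. \<forall>d\<in>D. comm d z = \<one>}"
  note str = derived_subgroup_structure[OF odd D_def cD W_def cW Z_def]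
  have Dn: "D \<lhd> G" unfolding D_def by (rule derived_is_normal[OF carrier_normal])
  have Wn: "W \<lhd> G" unfolding W_def by (rule derived_is_normal[OF Dn])
  interpret D: normal D G by (rule Dn)
  interpret W: normal W G by (rule Wn)
  have p1: "p > 1" using prime_gt_1_nat[OF prime] .
  have WD: "W \<subseteq> D" unfolding W_def by (rule derived_incl[OF subset_refl D.subgroup_axioms])
  have Wc: "comm g w = \<one>" if "g \<in> carrier G" "w \<in> W" for g w
    using normal_order_p_central[OF Wn cW that(2,1)] .
  have DW: "comm d w = \<one>" if "d \<in> D" "w \<in> W" for d w using Wc that by simp
  have DD: "comm d e \<in> W" if "d \<in> D" "e \<in> D" for d e
    unfolding W_def using that by (rule comm_in_derived[OF D.subgroup_axioms])
  have "card (derived G D) \<noteq> 1" using cW p1 by (simp flip: W_def)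
  then obtain x y where x: "x \<in> D" and y: "y \<in> D" and xy: "comm x y \<noteq> \<one>"
    by (rule derived_neq_oneE[OF D.subgroup_axioms])
  have c: "x \<in> carrier G" "y \<in> carrier G" using x y by auto
  have Zn: "Z \<lhd> G" unfolding Z_def by (rule center_normal[OF Dn])
  interpret Z: normal Z G by (rule Zn)
  have ZD: "Z \<subseteq> D" by (auto simp: Z_def)
  have WZ: "W \<subseteq> Z" using WD DW by (auto simp: Z_def)
  have DZ: "comm d z = \<one>" if "d \<in> D" "z \<in> Z" for d z using that by (simp add: Z_def)
  have cZW: "card Z = p * card W" using str(1) cW by (simp add: power2_eq_square)
  have lt: "card W < card Z" using cZW cW p1 by simp
  obtain u where u: "u \<in> Z" "u \<notin> W"
    using ex_not_in_smaller[OF W.subgroup_axioms lt] by (elim bexE)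
  have uc: "u \<in> carrier G" using u by simp
  have up: "u [^] p = \<one>" by (rule str(2)[OF u(1)])
  note upow = W.prime_index_powers[OF Z.subgroup_axioms WZ cZW prime fin u]
  have ucom: "u [^] n \<otimes> d = d \<otimes> u [^] n" if "d \<in> D" for d and n :: nat
    using DZ[OF that Z.nat_pow_mem[OF u(1), of n]] that uc by (simp add: comm_eq_one_iff')
  define z where "z = comm x y"
  have zW: "z \<in> W" unfolding z_def by (rule DD[OF x y])
  have z: "z \<in> carrier G" using zW by simp
  have z_pow: "z [^] n = \<one> \<longleftrightarrow> p dvd n" for n :: nat
    using prime_order_subgroup(1)[OF W.subgroup_axioms cW prime fin zW] xy by (simp add: z_def)
  have wcom: "w \<otimes> t = t \<otimes> w" if "t \<in> carrier G" "w \<in> W" for t w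
    using Wc[OF that] that by (simp add: comm_eq_one_iff')
  have "x \<otimes> y = conjg x y \<otimes> x" using c by (simp add: conjg_def m_assoc)
  also have "\<dots> = y \<otimes> (z \<otimes> x)" using c by (simp add: conjg_eq m_assoc z_def)
  finally have com: "x \<otimes> y = y \<otimes> (x \<otimes> z)" using wcom[OF c(1) zW] by simp
  note xy_pow = pow_commute_class2[OF c z com wcom[OF c(1) zW] wcom[OF c(2) zW]]
  \<comment> \<open>\<open>H\<close> is the set of normal forms of the subgroup generated by x, y
    and \<open>W\<close>. Membership in \<open>UNIV\<close> fixes the exponents as naturals,
    \<open>[^]\<close> being overloaded.\<close>
  define H where "H = {y [^] i \<otimes> (x [^] j \<otimes> w) | i j w. i \<in> (UNIV :: nat set) \<and> j \<in> (UNIV :: nat set) \<and> w \<in> W}"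
  have HI: "y [^] i \<otimes> (x [^] j \<otimes> w) \<in> H" if "w \<in> W" for i j :: nat and w
    using that unfolding H_def by blast
  have HE: "\<exists>(i::nat) (j::nat) w. w \<in> W \<and> t = y [^] i \<otimes> (x [^] j \<otimes> w)" if "t \<in> H" for t
    using that unfolding H_def by blast
  have HD: "H \<subseteq> D"
    using x y WD D.nat_pow_mem by (auto simp: H_def intro!: D.m_closed)
  have H: "subgroup H G"
  proof (rule finite_subgroupI[OF fin])
    show "H \<subseteq> carrier G" using HD D.subset by blast
    show "H \<noteq> {}" using HI[OF zW] by blast
    fix a b assume "a \<in> H" "b \<in> H"
    then obtain i j i' j' :: nat and w w' where w: "w \<in> W" "w' \<in> W"
      and ab: "a = y [^] i \<otimes> (x [^] j \<otimes> w)" "b = y [^] i' \<otimes> (x [^] j' \<otimes> w')"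
      using HE by metis
    have wc: "w \<in> carrier G" "w' \<in> carrier G" using w by auto
    have "a \<otimes> b = y [^] i \<otimes> (x [^] j \<otimes> ((w \<otimes> y [^] i') \<otimes> (x [^] j' \<otimes> w')))"
      using c wc by (simp add: ab m_assoc)
    also have "\<dots> = y [^] i \<otimes> ((x [^] j \<otimes> y [^] i') \<otimes> ((w \<otimes> x [^] j') \<otimes> w'))"
      unfolding wcom[OF nat_pow_closed[OF c(2)] w(1)] using c wc by (simp add: m_assoc)
    also have "\<dots> = y [^] i \<otimes> (y [^] i' \<otimes> (x [^] j \<otimes> ((z [^] (j * i') \<otimes> x [^] j') \<otimes> (w \<otimes> w'))))"
      unfolding wcom[OF nat_pow_closed[OF c(1)] w(1)] xy_pow using c wc z by (simp add: m_assoc)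
    also have "\<dots> = y [^] (i + i') \<otimes> (x [^] (j + j') \<otimes> (z [^] (j * i') \<otimes> (w \<otimes> w')))"
      unfolding wcom[OF nat_pow_closed[OF c(1)] W.nat_pow_mem[OF zW]] using c wc z
      by (simp add: m_assoc flip: nat_pow_mult)
    also have "\<dots> \<in> H" using w W.nat_pow_mem[OF zW] by (intro HI) simp
    finally show "a \<otimes> b \<in> H" .
  qed
  interpret H: subgroup H G by (rule H)
  have xH: "x \<in> H" using HI[OF W.one_closed, of 0 1] c by simp
  have yH: "y \<in> H" using HI[OF W.one_closed, of 1 0] c by simp
  \<comment> \<open>A power of u is central in \<open>D\<close>. Commuting its normal form with x
    and with y gives z^i = 1 and z^j = 1, so p divides i and j. As p-th powers of elements of
    \<open>D\<close> lie in \<open>W\<close>, the whole element is in \<open>W\<close>, where u has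
    only trivial powers.\<close>
  have Hu: "u [^] m = \<one>" if m: "u [^] m \<in> H" for m :: nat
  proof -
    obtain i j :: nat and w where w: "w \<in> W" and um: "u [^] m = y [^] i \<otimes> (x [^] j \<otimes> w)"
      using HE[OF m] by blast
    have wc: "w \<in> carrier G" using w by simp
    have "p dvd i"
    proof -
      have "x \<otimes> (y [^] i \<otimes> (x [^] j \<otimes> w)) = (y [^] i \<otimes> (x [^] j \<otimes> w)) \<otimes> x"
        using ucom[OF x, of m] um by simp
      also have "\<dots> = y [^] i \<otimes> (x [^] j \<otimes> (w \<otimes> x))" using c wc by (simp add: m_assoc)
      also have "\<dots> = y [^] i \<otimes> ((x [^] j \<otimes> x) \<otimes> w)"
        unfolding wcom[OF c(1) w] using c wc by (simp add: m_assoc)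
      also have "x [^] j \<otimes> x = x \<otimes> x [^] j" using c by (metis nat_pow_Suc nat_pow_Suc2)
      also have "y [^] i \<otimes> (x \<otimes> x [^] j \<otimes> w) = y [^] i \<otimes> (x \<otimes> (x [^] j \<otimes> w))"
        using c wc by (simp add: m_assoc)
      finally have 1: "x \<otimes> (y [^] i \<otimes> (x [^] j \<otimes> w)) = y [^] i \<otimes> (x \<otimes> (x [^] j \<otimes> w))" .
      have "x \<otimes> (y [^] i \<otimes> (x [^] j \<otimes> w)) = (x [^] (1::nat) \<otimes> y [^] i) \<otimes> (x [^] j \<otimes> w)"
        using c wc by (simp add: m_assoc)
      also have "\<dots> = y [^] i \<otimes> (x \<otimes> (z [^] i \<otimes> (x [^] j \<otimes> w)))"
        unfolding xy_pow using c wc z by (simp add: m_assoc)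
      finally have "z [^] i \<otimes> (x [^] j \<otimes> w) = x [^] j \<otimes> w" using 1 c wc z by simp
      then have "z [^] i = \<one>" using c wc z by simp
      then show ?thesis using z_pow by simp
    qed
    moreover have "p dvd j"
    proof -
      have "y \<otimes> (y [^] i \<otimes> (x [^] j \<otimes> w)) = (y [^] i \<otimes> (x [^] j \<otimes> w)) \<otimes> y"
        using ucom[OF y, of m] um by simp
      also have "\<dots> = y [^] i \<otimes> (x [^] j \<otimes> (w \<otimes> y))" using c wc by (simp add: m_assoc)
      also have "\<dots> = y [^] i \<otimes> ((x [^] j \<otimes> y [^] (1::nat)) \<otimes> w)"
        unfolding wcom[OF c(2) w] using c wc by (simp add: m_assoc)
      also have "\<dots> = (y [^] i \<otimes> y) \<otimes> (x [^] j \<otimes> (z [^] j \<otimes> w))"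
        unfolding xy_pow using c wc z by (simp add: m_assoc)
      also have "y [^] i \<otimes> y = y \<otimes> y [^] i" using c by (metis nat_pow_Suc nat_pow_Suc2)
      finally have "z [^] j \<otimes> w = w" using c wc z by (simp add: m_assoc)
      then have "z [^] j = \<one>" using wc z by simp
      then show ?thesis using z_pow by simp
    qed
    ultimately obtain k l where ij: "i = p * k" "j = p * l" by (auto elim!: dvdE)
    have "y [^] i \<in> W" "x [^] j \<in> W"
      using W.nat_pow_mem[OF str(3)[OF y], of k] W.nat_pow_mem[OF str(3)[OF x], of l] c
      by (simp_all add: ij nat_pow_pow)
    then have "u [^] m \<in> W" unfolding um using w by simp
    then obtain n where n: "m = p * n" using upow(1) by (auto elim!: dvdE)
    have "(u [^] p) [^] n = \<one>" unfolding up by simp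
    then show ?thesis using uc by (simp add: n nat_pow_pow)
  qed
  \<comment> \<open>D is generated by y, x and \<open>Z\<close>, and \<open>Z\<close> by u and
    \<open>W\<close>; the power of u is central and can be moved to the end.\<close>
  have dec: "\<exists>h\<in>H. \<exists>m::nat. t = h \<otimes> u [^] m" if t: "t \<in> D" for t
  proof -
    obtain i j :: nat and e where e: "e \<in> D" "comm e x = \<one>" "comm e y = \<one>" "t = y [^] i \<otimes> (x [^] j \<otimes> e)"
      using two_generators_mod_centralizer(2)[OF fin prime D.subgroup_axioms W.subgroup_axioms cW DW DD x y xy t]
      by blast
    have "e \<in> Z"
      using class2_centralizer_central[OF fin prime D.subgroup_axioms Wn cW WD DW DD x y xy _ e(1-3)] cD e(1)
      unfolding Z_def by blast
    then obtain m :: nat and w where w: "w \<in> W" "e = u [^] m \<otimes> w" using upow(2) by blast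
    then have wc: "w \<in> carrier G" by simp
    have "t = (y [^] i \<otimes> (x [^] j \<otimes> w)) \<otimes> u [^] m"
      using c wc uc by (simp add: e(4) w(2) m_assoc wcom[OF nat_pow_closed[OF uc] w(1)])
    then show ?thesis using HI[OF w(1)] by blast
  qed
  let ?P = "G\<lparr>carrier := H\<rparr> \<times>\<times> integer_mod_group p"
  let ?f = "\<lambda>(h, m). h \<otimes> u [^] nat m"
  have carP: "carrier ?P = H \<times> {0..<int p}" using p1 by (simp add: carrier_integer_mod_group)
  interpret P: group ?P
    by (intro DirProd_group subgroup_imp_group[OF H] group_integer_mod_group)
  interpret DG: group "G\<lparr>carrier := D\<rparr>" by (rule subgroup_imp_group[OF D.subgroup_axioms])
  have hom: "?f \<in> hom ?P (G\<lparr>carrier := D\<rparr>)"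
  proof (rule homI)
    fix s assume "s \<in> carrier ?P"
    then show "?f s \<in> carrier (G\<lparr>carrier := D\<rparr>)"
      using HD ZD Z.nat_pow_mem[OF u(1)] unfolding carP by (auto intro!: D.m_closed)
  next
    fix s t assume "s \<in> carrier ?P" "t \<in> carrier ?P"
    then obtain h h' and m m' :: nat where s: "s = (h, int m)" "t = (h', int m')" and h: "h \<in> H" "h' \<in> H"
      unfolding carP by (cases s; cases t) (auto elim!: nonneg_int_cases)
    have hc: "h \<in> carrier G" "h' \<in> carrier G" using h by auto
    have st: "s \<otimes>\<^bsub>?P\<^esub> t = (h \<otimes> h', int ((m + m') mod p))" by (simp add: s zmod_int)
    have "?f s \<otimes> ?f t = h \<otimes> ((u [^] m \<otimes> h') \<otimes> u [^] m')" using hc uc by (simp add: s m_assoc)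
    also have "\<dots> = h \<otimes> h' \<otimes> u [^] (m + m')"
      unfolding ucom[OF subsetD[OF HD h(2)]] using hc uc by (simp add: m_assoc flip: nat_pow_mult)
    finally show "?f (s \<otimes>\<^bsub>?P\<^esub> t) = ?f s \<otimes>\<^bsub>G\<lparr>carrier := D\<rparr>\<^esub> ?f t"
      using hc uc by (simp add: st pow_mod_eq up)
  qed
  interpret h: group_hom ?P "G\<lparr>carrier := D\<rparr>" ?f
    by unfold_locales (rule hom)
  have "?f \<in> iso ?P (G\<lparr>carrier := D\<rparr>)"
    unfolding h.iso_iff
  proof (intro conjI ballI impI subsetI)
    fix t assume "t \<in> carrier (G\<lparr>carrier := D\<rparr>)"
    then have "t \<in> D" by simp
    then obtain h and m :: nat where hm: "h \<in> H" "t = h \<otimes> u [^] m" using dec by blast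
    then have "t = ?f (h, int (m mod p))" using uc by (simp add: pow_mod_eq up)
    moreover have "(h, int (m mod p)) \<in> carrier ?P" unfolding carP using hm(1) p1 by simp
    ultimately show "t \<in> ?f ` carrier ?P" by blast
  next
    fix s assume "s \<in> carrier ?P" and s1: "?f s = \<one>\<^bsub>G\<lparr>carrier := D\<rparr>\<^esub>"
    then obtain h and m :: nat where s: "s = (h, int m)" and h: "h \<in> H" and m: "m < p"
      unfolding carP by (cases s) (auto elim!: nonneg_int_cases)
    have hc: "h \<in> carrier G" using h by simp
    have hu: "h \<otimes> u [^] m = \<one>" using s1 by (simp add: s)
    then have "u [^] m = inv h" using hc uc by (metis inv_equality inv_inv inv_closed nat_pow_closed)
    then have "u [^] m \<in> H" using h by simp
    then have um: "u [^] m = \<one>" by (rule Hu)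
    then have "u [^] m \<in> W" by simp
    then have "p dvd m" using upow(1) by blast
    then have "m = 0" using m by (auto dest: dvd_imp_le)
    moreover have "h = \<one>" using hu hc um by simp
    ultimately show "s = \<one>\<^bsub>?P\<^esub>" by (simp add: s)
  qed
  then have iso: "?P \<cong> G\<lparr>carrier := D\<rparr>" by (auto simp: is_iso_def)
  then have "card H * p = p ^ 4"
    using iso_same_card[OF iso] cD carP p1 by (simp add: card_cartesian_product carrier_integer_mod_group)
  then have "card H = p ^ 3" using p1 by (simp add: power_numeral_reduce)
  moreover have "\<not> comm_group (G\<lparr>carrier := H\<rparr>)"
  proof
    assume "comm_group (G\<lparr>carrier := H\<rparr>)"
    then interpret HG: comm_group "G\<lparr>carrier := H\<rparr>" .
    have "x \<otimes> y = y \<otimes> x" using HG.m_comm xH yH by simp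
    then show False using xy c by (simp add: comm_eq_one_iff')
  qed
  moreover have "G\<lparr>carrier := D\<rparr> \<cong> ?P" by (rule P.iso_sym[OF iso])
  ultimately show ?thesis using H by blast
qed

end

section \<open>Identification of the chosen representatives, and the theorem\<close>

lemma heis_iso_X_p3:
  assumes "Factorial_Ring.prime p" "p \<ge> 3"
  shows "heis p \<cong> X_p3 p"
proof -
  have X: "nonabelian_p3_group p p (X_p3 p)" by (rule X_p3_props[OF assms])
  interpret p_group "X_p3 p" p by (rule p_group_if_nonabelian_p3[OF X assms(1)])
  \<comment> \<open>\<open>group_exponent\<close> is a least element; the group order witnesses that
    one exists, so the value p really is an exponent.\<close>
  have "\<exists>n::nat. n > 0 \<and> (\<forall>x\<in>carrier (X_p3 p). x [^]\<^bsub>X_p3 p\<^esub> n = \<one>\<^bsub>X_p3 p\<^esub>)"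
    using order_gt_0_iff_finite fin by (intro exI[of _ "order (X_p3 p)"]) (simp add: pow_order_eq_1)
  from LeastI_ex[OF this] have "\<forall>x\<in>carrier (X_p3 p). x [^]\<^bsub>X_p3 p\<^esub> p = \<one>\<^bsub>X_p3 p\<^esub>"
    using X by (simp add: nonabelian_p3_group_def group_exponent_def)
  then show ?thesis using X assms(2) by (intro heis_iso) (auto simp: nonabelian_p3_group_def)
qed

lemma modular_iso_Y_p3:
  assumes "Factorial_Ring.prime p" "p \<ge> 3"
  shows "modular p \<cong> Y_p3 p"
proof -
  have Y: "nonabelian_p3_group p (p ^ 2) (Y_p3 p)" by (rule Y_p3_props[OF assms])
  interpret p_group "Y_p3 p" p by (rule p_group_if_nonabelian_p3[OF Y assms(1)])
  have "\<exists>x\<in>carrier (Y_p3 p). x [^]\<^bsub>Y_p3 p\<^esub> p \<noteq> \<one>\<^bsub>Y_p3 p\<^esub>"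
  proof (rule ccontr)
    assume "\<not> ?thesis"
    then have "group_exponent (Y_p3 p) \<le> p"
      unfolding group_exponent_def using assms(2) by (intro Least_le) auto
    then show False using Y assms(2) by (simp add: nonabelian_p3_group_def power2_eq_square)
  qed
  then show ?thesis using Y assms(2) by (intro modular_iso) (auto simp: nonabelian_p3_group_def)
qed

theorem theorem5p3:
  fixes G :: "('a, 'b) monoid_scheme" and p :: nat
  assumes "Factorial_Ring.prime p" and "p \<ge> 3"
    and "group G" and "finite (carrier G)" and "\<exists>n. order G = p ^ n"
    and "order (derived_subgroup G Mod carrier (derived_subgroup (derived_subgroup G))) = p ^ 3"
    and "carrier (derived_subgroup (derived_subgroup G)) \<noteq> {\<one>\<^bsub>G\<^esub>}"
  shows "derived_subgroup G \<cong> X_p3 p \<times>\<times> integer_mod_group p \<or>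
         derived_subgroup G \<cong> Y_p3 p \<times>\<times> integer_mod_group p"
proof -
  interpret p_group G p using assms by (simp add: p_group_def p_group_axioms_def)
  have odd: "odd p" using assms(1,2) prime_odd_nat[of p] by auto
  have p1: "p > 1" using assms(2) by simp
  define D W where "D = derived G (carrier G)" and "W = derived G D"
  have Dn: "D \<lhd> G" unfolding D_def by (rule derived_is_normal[OF carrier_normal])
  have Wn: "W \<lhd> G" unfolding W_def by (rule derived_is_normal[OF Dn])
  interpret D: normal D G by (rule Dn)
  interpret W: normal W G by (rule Wn)
  have WD: "W \<subseteq> D" unfolding W_def by (rule derived_incl[OF subset_refl D.subgroup_axioms])
  have GD: "derived_subgroup G = G\<lparr>carrier := D\<rparr>" by (simp add: derived_subgroup_def D_def)
  have GW: "carrier (derived_subgroup (derived_subgroup G)) = W"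
    unfolding GD using derived_consistent[OF subset_refl D.subgroup_axioms]
    by (simp add: derived_subgroup_def W_def)
  interpret DG: group "G\<lparr>carrier := D\<rparr>" by (rule subgroup_imp_group[OF D.subgroup_axioms])
  have "subgroup W (G\<lparr>carrier := D\<rparr>)"
    by (rule subgroup_incl[OF W.subgroup_axioms D.subgroup_axioms WD])
  from DG.lagrange[OF this] have cDW: "card D = p ^ 3 * card W"
    using assms(6)[unfolded GW, unfolded GD] by (simp add: order_def FactGroup_def)
  obtain k where k: "card W = p ^ k" using card_subgroup[OF W.subgroup_axioms] by blast
  have "W \<noteq> {\<one>\<^bsub>G\<^esub>}" using assms(7) GW by simp
  have "k \<noteq> 0"
  proof
    assume "k = 0"
    then obtain t where "W = {t}" using k by (auto simp: card_1_singleton_iff)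
    moreover have "\<one>\<^bsub>G\<^esub> \<in> W" by (rule subgroup.one_closed[OF W.subgroup_axioms])
    ultimately show False using \<open>W \<noteq> {\<one>\<^bsub>G\<^esub>}\<close> by simp
  qed
  have "k = 1"
  proof (rule ccontr)
    assume "k \<noteq> 1"
    with \<open>k \<noteq> 0\<close> obtain j where j: "k = j + 2" by (metis One_nat_def Suc_1 add.commute add_2_eq_Suc not0_implies_Suc)
    \<comment> \<open>Dividing by a normal subgroup of order p^j inside \<open>W\<close> leaves
      orders p^2 and p^5 for the images of \<open>W\<close> and \<open>D\<close>, the case excluded
      by \<open>card_second_derived_neq_p2\<close>.\<close>
    have "\<exists>L. L \<lhd> G \<and> {\<one>\<^bsub>G\<^esub>} \<subseteq> L \<and> L \<subseteq> W \<and> card L = p ^ j"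
      using subgroup.one_closed[OF W.subgroup_axioms] j
      by (intro normal_chain[OF one_is_normal _ Wn k, of 0]) auto
    then obtain N where Nn: "N \<lhd> G" and NW: "N \<subseteq> W" and cN: "card N = p ^ j" by blast
    interpret N: normal N G by (rule Nn)
    interpret Q: p_group "G Mod N" p by (rule p_group_quotient[OF Nn])
    interpret q: group_hom G "G Mod N" "r_coset G N" by (rule N.quotient_hom)
    have QD: "derived (G Mod N) (carrier (G Mod N)) = r_coset G N ` D"
      unfolding D_def carrier_FactGroup by (rule q.derived_img) simp
    have QW: "derived (G Mod N) (r_coset G N ` D) = r_coset G N ` W"
      unfolding W_def by (rule q.derived_img[OF D.subset])
    have "card W = card (r_coset G N ` W) * card N"
      by (rule N.card_image_coset[OF W.subgroup_axioms finite_subgroup[OF W.subgroup_axioms] NW])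
    then have 1: "card (r_coset G N ` W) = p\<^sup>2" using k j cN p1 by (simp add: power_add power2_eq_square)
    have "card D = card (r_coset G N ` D) * card N"
      using NW WD by (intro N.card_image_coset[OF D.subgroup_axioms finite_subgroup[OF D.subgroup_axioms]]) blast
    then have 2: "card (r_coset G N ` D) = p ^ 5"
      using cDW k j cN p1 by (simp add: power_add power2_eq_square power_numeral_reduce)
    show False using Q.card_second_derived_neq_p2[OF odd] 1 2 by (simp add: QD QW)
  qed
  then have cW: "card W = p" and cD: "card D = p ^ 4" using k cDW by (simp_all add: power_numeral_reduce)
  obtain H where H: "subgroup H G" and cH: "card H = p ^ 3" and nc: "\<not> comm_group (G\<lparr>carrier := H\<rparr>)"
    and iso: "G\<lparr>carrier := D\<rparr> \<cong> G\<lparr>carrier := H\<rparr> \<times>\<times> integer_mod_group p"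
    using derived_subgroup_direct_factor[OF odd D_def cD W_def cW] by blast
  let ?H = "G\<lparr>carrier := H\<rparr>"
  have oH: "order ?H = p ^ 3" using cH by (simp add: order_def)
  interpret H: p_group ?H p
    using subgroup_imp_group[OF H] assms(1) finite_subgroup[OF H] oH
    by (auto simp: p_group_def p_group_axioms_def)
  interpret heis: group "heis p" using p1 by (intro heis_group) simp
  interpret modular: group "modular p" using p1 by (intro modular_group) simp
  show ?thesis
  \<comment> \<open>\<open>X_p3\<close> and \<open>Y_p3\<close> are arbitrary choices, so
    \<open>H\<close> is compared with them through the explicit models \<open>heis\<close> and
    \<open>modular\<close>.\<close>
  proof (cases "\<forall>t\<in>H. t [^]\<^bsub>?H\<^esub> p = \<one>\<^bsub>?H\<^esub>")
    case True
    then have "heis p \<cong> ?H" using H.heis_iso[OF oH nc assms(2)] by simp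
    then have "?H \<cong> X_p3 p" using heis.iso_sym iso_trans heis_iso_X_p3[OF assms(1,2)] by blast
    then have "?H \<times>\<times> integer_mod_group p \<cong> X_p3 p \<times>\<times> integer_mod_group p"
      by (rule H.DirProd_iso_trans) (rule iso_refl)
    then show ?thesis unfolding GD using iso iso_trans by blast
  next
    case False
    then have "modular p \<cong> ?H" using H.modular_iso[OF oH nc assms(2)] by simp
    then have "?H \<cong> Y_p3 p" using modular.iso_sym iso_trans modular_iso_Y_p3[OF assms(1,2)] by blast
    then have "?H \<times>\<times> integer_mod_group p \<cong> Y_p3 p \<times>\<times> integer_mod_group p"
      by (rule H.DirProd_iso_trans) (rule iso_refl)
    then show ?thesis unfolding GD using iso iso_trans by blast
  qed
qed

end
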